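(* Let $V_1,V_2$ be models of $ZF$ such that $V_2$ is a set of $V_1$, and let $f:\omega(V_1)\to\omega(V_2)$ be a map such that $V_2$ initial-segment number extends $V_1$ using $f$. Let $T_1\in\omega(V_1)$ be a code of a Turing machine and let $z\in\omega(V_1)$. Let $R(T_1,z)\in\omega(V_1)$ be the coded state of the machine $T_1$ after $z$ steps, computed in $V_1$, and let $R(f(T_1),f(z))\in\omega(V_2)$ be the coded state of the machine $f(T_1)$ after $f(z)$ steps, computed in $V_2$. Then \[ f\bigl(R(T_1,z)\bigr)=R\bigl(f(T_1),f(z)\bigr). \]
   Context: For a model $M$ of $ZF$, $\omega(M)$ denotes the $\omega$ of $M$ (least set containing $\emptyset$ and closed under $x\mapsto x\cup\{x\}$, computed in $M$). A model $V_2$ of $ZF$ is a set of (is inside) $V_1$ if $V_2$ is a set within $V_1$, all sets of $V_2$ are sets of $V_1$, and the relation $\in_{V_2}$, as a set of pairs, is a set of $V_1$. $V_2$ initial-segment number extends $V_1$ using $f:\omega(V_1)\to\omega(V_2)$ if: $f(a+_1b)=f(a)+_2f(b)$, $f(a\cdot_1 b)=f(a)\cdot_2 f(b)$, $f(a^b)=f(a)^{f(b)}$ for all $a,b\in\omega(V_1)$, $f(0_{V_1})=0_{V_2}$, $f(1_{V_1})=1_{V_2}$, and for every $b\in\omega(V_1)$ and $a\in\omega(V_2)$ with $a<_2 f(b)$ there is $c\in\omega(V_1)$ with $a=f(c)$ (here operations with subscript $i$ are those of $\omega(V_i)$ computed in $V_i$). Turing machines (RAM machines) and their configurations are coded by natural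 numbers via a fixed arithmetical (text-to-integer) coding, and the one-step transition function on coded states is expressible by arithmetic operations. *)

theory Defs
  imports Main "HOL-Library.FuncSet"
begin

section \<open>Models of ZF\<close>

record 'a struct =
  dom :: "'a set"
  mem :: "'a \<Rightarrow> 'a \<Rightarrow> bool" (infix "\<epsilon>\<index>" 50)

text \<open>Formulas of the language of set theory, with named variables.\<close>

datatype fm =
    Member nat nat
  | Equal nat nat
  | Neg fm
  | Conj fm fm
  | Forall nat fm

primrec sat :: "('a, 'b) struct_scheme \<Rightarrow> (nat \<Rightarrow> 'a) \<Rightarrow> fm \<Rightarrow> bool" where
  "sat M e (Member i j) \<longleftrightarrow> e i \<epsilon>\<^bsub>M\<^esub> e j"
| "sat M e (Equal i j) \<longleftrightarrow> e i = e j"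
| "sat M e (Neg p) \<longleftrightarrow> \<not> sat M e p"
| "sat M e (Conj p q) \<longleftrightarrow> sat M e p \<and> sat M e q"
| "sat M e (Forall i p) \<longleftrightarrow> (\<forall>x\<in>dom M. sat M (e(i := x)) p)"

definition is_empty :: "('a, 'b) struct_scheme \<Rightarrow> 'a \<Rightarrow> bool" where
  "is_empty M x \<longleftrightarrow> x \<in> dom M \<and> (\<forall>z\<in>dom M. \<not> z \<epsilon>\<^bsub>M\<^esub> x)"

definition is_succ :: "('a, 'b) struct_scheme \<Rightarrow> 'a \<Rightarrow> 'a \<Rightarrow> bool" where
  "is_succ M x s \<longleftrightarrow> s \<in> dom M \<and> (\<forall>z\<in>dom M. z \<epsilon>\<^bsub>M\<^esub> s \<longleftrightarrow> z \<epsilon>\<^bsub>M\<^esub> x \<or> z = x)"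

definition inductive_in :: "('a, 'b) struct_scheme \<Rightarrow> 'a \<Rightarrow> bool" where
  "inductive_in M w \<longleftrightarrow> w \<in> dom M
     \<and> (\<exists>z\<in>dom M. is_empty M z \<and> z \<epsilon>\<^bsub>M\<^esub> w)
     \<and> (\<forall>x\<in>dom M. x \<epsilon>\<^bsub>M\<^esub> w \<longrightarrow> (\<exists>s\<in>dom M. is_succ M x s \<and> s \<epsilon>\<^bsub>M\<^esub> w))"

text \<open>
  In the two schemes the parameters of the formula are supplied by the
  environment \<open>e\<close>; the designated variables are number \<open>0\<close> (and \<open>1\<close>).
\<close>

definition ZF_model :: "('a, 'b) struct_scheme \<Rightarrow> bool" where
  "ZF_model M \<longleftrightarrow>
     \<comment> \<open>Extensionality\<close>
     (\<forall>x\<in>dom M. \<forall>y\<in>dom M. (\<forall>z\<in>dom M. z \<epsilon>\<^bsub>M\<^esub> x \<longleftrightarrow> z \<epsilon>\<^bsub>M\<^esub> y) \<longrightarrow> x = y)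
     \<comment> \<open>Foundation\<close>
   \<and> (\<forall>x\<in>dom M. (\<exists>y\<in>dom M. y \<epsilon>\<^bsub>M\<^esub> x) \<longrightarrow>
        (\<exists>y\<in>dom M. y \<epsilon>\<^bsub>M\<^esub> x \<and> \<not> (\<exists>z\<in>dom M. z \<epsilon>\<^bsub>M\<^esub> y \<and> z \<epsilon>\<^bsub>M\<^esub> x)))
     \<comment> \<open>Pairing\<close>
   \<and> (\<forall>x\<in>dom M. \<forall>y\<in>dom M. \<exists>u\<in>dom M. \<forall>z\<in>dom M. z \<epsilon>\<^bsub>M\<^esub> u \<longleftrightarrow> z = x \<or> z = y)
     \<comment> \<open>Union\<close>
   \<and> (\<forall>x\<in>dom M. \<exists>u\<in>dom M. \<forall>z\<in>dom M.
        z \<epsilon>\<^bsub>M\<^esub> u \<longleftrightarrow> (\<exists>y\<in>dom M. z \<epsilon>\<^bsub>M\<^esub> y \<and> y \<epsilon>\<^bsub>M\<^esub> x))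
     \<comment> \<open>Power set\<close>
   \<and> (\<forall>x\<in>dom M. \<exists>u\<in>dom M. \<forall>z\<in>dom M.
        z \<epsilon>\<^bsub>M\<^esub> u \<longleftrightarrow> (\<forall>y\<in>dom M. y \<epsilon>\<^bsub>M\<^esub> z \<longrightarrow> y \<epsilon>\<^bsub>M\<^esub> x))
     \<comment> \<open>Infinity\<close>
   \<and> (\<exists>w\<in>dom M. inductive_in M w)
     \<comment> \<open>Separation\<close>
   \<and> (\<forall>p e x. range e \<subseteq> dom M \<longrightarrow> x \<in> dom M \<longrightarrow>
        (\<exists>u\<in>dom M. \<forall>z\<in>dom M. z \<epsilon>\<^bsub>M\<^esub> u \<longleftrightarrow> z \<epsilon>\<^bsub>M\<^esub> x \<and> sat M (e(0 := z)) p))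
     \<comment> \<open>Replacement\<close>
   \<and> (\<forall>p e x. range e \<subseteq> dom M \<longrightarrow> x \<in> dom M \<longrightarrow>
        (\<forall>a\<in>dom M. a \<epsilon>\<^bsub>M\<^esub> x \<longrightarrow>
           (\<forall>b\<in>dom M. \<forall>c\<in>dom M. sat M (e(0 := a, 1 := b)) p \<longrightarrow>
              sat M (e(0 := a, 1 := c)) p \<longrightarrow> b = c)) \<longrightarrow>
        (\<exists>u\<in>dom M. \<forall>b\<in>dom M.
           b \<epsilon>\<^bsub>M\<^esub> u \<longleftrightarrow> (\<exists>a\<in>dom M. a \<epsilon>\<^bsub>M\<^esub> x \<and> sat M (e(0 := a, 1 := b)) p)))"


section \<open>Set-theoretic notions computed in a model\<close>

definition vempty :: "('a, 'b) struct_scheme \<Rightarrow> 'a" where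
  "vempty M = (THE x. is_empty M x)"

definition vsucc :: "('a, 'b) struct_scheme \<Rightarrow> 'a \<Rightarrow> 'a" where
  "vsucc M x = (THE s. is_succ M x s)"

definition omega :: "('a, 'b) struct_scheme \<Rightarrow> 'a" where
  "omega M = (THE w. inductive_in M w \<and>
     (\<forall>u. inductive_in M u \<longrightarrow> (\<forall>x\<in>dom M. x \<epsilon>\<^bsub>M\<^esub> w \<longrightarrow> x \<epsilon>\<^bsub>M\<^esub> u)))"

definition nats :: "('a, 'b) struct_scheme \<Rightarrow> 'a set" where
  "nats M = {n \<in> dom M. n \<epsilon>\<^bsub>M\<^esub> omega M}"

definition upair :: "('a, 'b) struct_scheme \<Rightarrow> 'a \<Rightarrow> 'a \<Rightarrow> 'a" where
  "upair M x y = (THE u. u \<in> dom M \<and> (\<forall>z\<in>dom M. z \<epsilon>\<^bsub>M\<^esub> u \<longleftrightarrow> z = x \<or> z = y))"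

definition opair :: "('a, 'b) struct_scheme \<Rightarrow> 'a \<Rightarrow> 'a \<Rightarrow> 'a" where
  "opair M x y = upair M (upair M x x) (upair M x y)"

text \<open>\<open>h\<close> is, in \<open>M\<close>, a function (a set of Kuratowski pairs) with domain \<open>d\<close>.\<close>

definition is_fun :: "('a, 'b) struct_scheme \<Rightarrow> 'a \<Rightarrow> 'a \<Rightarrow> bool" where
  "is_fun M h d \<longleftrightarrow> h \<in> dom M
     \<and> (\<forall>p\<in>dom M. p \<epsilon>\<^bsub>M\<^esub> h \<longrightarrow> (\<exists>x\<in>dom M. \<exists>y\<in>dom M. x \<epsilon>\<^bsub>M\<^esub> d \<and> p = opair M x y))
     \<and> (\<forall>x\<in>dom M. x \<epsilon>\<^bsub>M\<^esub> d \<longrightarrow> (\<exists>!y. y \<in> dom M \<and> opair M x y \<epsilon>\<^bsub>M\<^esub> h))"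

definition app :: "('a, 'b) struct_scheme \<Rightarrow> 'a \<Rightarrow> 'a \<Rightarrow> 'a" where
  "app M h x = (THE y. y \<in> dom M \<and> opair M x y \<epsilon>\<^bsub>M\<^esub> h)"

text \<open>
  \<open>iterates M G a z r\<close>: starting from \<open>a\<close> and making \<open>z\<close> steps along the relation
  \<open>G\<close> one arrives at \<open>r\<close>, where the whole history of the process is a function in
  \<open>M\<close> with domain \<open>z + 1\<close>. The number \<open>z\<close> of steps may be nonstandard.
\<close>

definition iterates ::
  "('a, 'b) struct_scheme \<Rightarrow> ('a \<Rightarrow> 'a \<Rightarrow> bool) \<Rightarrow> 'a \<Rightarrow> 'a \<Rightarrow> 'a \<Rightarrow> bool" where
  "iterates M G a z r \<longleftrightarrow> (\<exists>h. is_fun M h (vsucc M z)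
     \<and> app M h (vempty M) = a
     \<and> (\<forall>i\<in>dom M. i \<epsilon>\<^bsub>M\<^esub> z \<longrightarrow> G (app M h i) (app M h (vsucc M i)))
     \<and> app M h z = r)"

definition nadd :: "('a, 'b) struct_scheme \<Rightarrow> 'a \<Rightarrow> 'a \<Rightarrow> 'a" (infixl "\<oplus>\<index>" 65) where
  "a \<oplus>\<^bsub>M\<^esub> b = (THE r. iterates M (\<lambda>x y. y = vsucc M x) a b r)"

definition nmul :: "('a, 'b) struct_scheme \<Rightarrow> 'a \<Rightarrow> 'a \<Rightarrow> 'a" (infixl "\<otimes>\<index>" 70) where
  "a \<otimes>\<^bsub>M\<^esub> b = (THE r. iterates M (\<lambda>x y. y = x \<oplus>\<^bsub>M\<^esub> a) (vempty M) b r)"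

definition npow :: "('a, 'b) struct_scheme \<Rightarrow> 'a \<Rightarrow> 'a \<Rightarrow> 'a" (infixr "\<up>\<index>" 75) where
  "a \<up>\<^bsub>M\<^esub> b = (THE r. iterates M (\<lambda>x y. y = x \<otimes>\<^bsub>M\<^esub> a) (vsucc M (vempty M)) b r)"

definition n_zero :: "('a, 'b) struct_scheme \<Rightarrow> 'a" ("\<zero>\<index>") where
  "\<zero>\<^bsub>M\<^esub> = vempty M"

definition n_one :: "('a, 'b) struct_scheme \<Rightarrow> 'a" ("\<one>\<index>") where
  "\<one>\<^bsub>M\<^esub> = vsucc M (vempty M)"

text \<open>The order of \<open>\<omega>\<close> is membership.\<close>

abbreviation nless :: "('a, 'b) struct_scheme \<Rightarrow> 'a \<Rightarrow> 'a \<Rightarrow> bool" (infix "\<prec>\<index>" 50) where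
  "a \<prec>\<^bsub>M\<^esub> b \<equiv> a \<epsilon>\<^bsub>M\<^esub> b"


section \<open>Models inside models and initial-segment number extensions\<close>

definition is_set_of :: "('a, 'b) struct_scheme \<Rightarrow> ('a, 'c) struct_scheme \<Rightarrow> bool" where
  "is_set_of V2 V1 \<longleftrightarrow>
     (\<exists>v\<in>dom V1. dom V2 = {x \<in> dom V1. x \<epsilon>\<^bsub>V1\<^esub> v})
   \<and> (\<exists>e\<in>dom V1. \<forall>p\<in>dom V1. p \<epsilon>\<^bsub>V1\<^esub> e \<longleftrightarrow>
        (\<exists>x\<in>dom V2. \<exists>y\<in>dom V2. x \<epsilon>\<^bsub>V2\<^esub> y \<and> p = opair V1 x y))"

definition initial_segment_number_extends ::
  "('a, 'b) struct_scheme \<Rightarrow> ('a, 'c) struct_scheme \<Rightarrow> ('a \<Rightarrow> 'a) \<Rightarrow> bool" where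
  "initial_segment_number_extends V2 V1 f \<longleftrightarrow>
     f \<in> nats V1 \<rightarrow> nats V2
   \<and> (\<forall>a\<in>nats V1. \<forall>b\<in>nats V1. f (a \<oplus>\<^bsub>V1\<^esub> b) = f a \<oplus>\<^bsub>V2\<^esub> f b)
   \<and> (\<forall>a\<in>nats V1. \<forall>b\<in>nats V1. f (a \<otimes>\<^bsub>V1\<^esub> b) = f a \<otimes>\<^bsub>V2\<^esub> f b)
   \<and> (\<forall>a\<in>nats V1. \<forall>b\<in>nats V1. f (a \<up>\<^bsub>V1\<^esub> b) = f a \<up>\<^bsub>V2\<^esub> f b)
   \<and> f \<zero>\<^bsub>V1\<^esub> = \<zero>\<^bsub>V2\<^esub>
   \<and> f \<one>\<^bsub>V1\<^esub> = \<one>\<^bsub>V2\<^esub>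
   \<and> (\<forall>b\<in>nats V1. \<forall>a\<in>nats V2. a \<prec>\<^bsub>V2\<^esub> f b \<longrightarrow> (\<exists>c\<in>nats V1. a = f c))"


section \<open>Turing machines coded by natural numbers, inside a model\<close>

text \<open>
  The machines are deterministic one-tape machines with a two-way infinite tape.
  A machine has states \<open>0, \<dots>, n - 1\<close> (start state \<open>0\<close>), a halting state \<open>n\<close>, and tape
  symbols \<open>0, \<dots>, k - 1\<close> (blank \<open>0\<close>). Its transition table has one instruction
  \<open>(q', a', m)\<close> (new state \<open>q' \<le> n\<close>, symbol \<open>a' < k\<close> to write, head move \<open>m < 3\<close>) for
  each state \<open>q < n\<close> and scanned symbol \<open>a < k\<close>; the instruction is the number
  \<open>(q' k + a') 3 + m < 3 k (n + 1)\<close>. The table is a text of length \<open>n k\<close> over the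
  alphabet of these numbers, turned into an integer \<open>t\<close> by reading it in base
  \<open>3 k (n + 1)\<close>; the instruction for \<open>(q, a)\<close> is the digit of weight
  \<open>(3 k (n + 1)) ^ (q k + a)\<close>.

  A state of the computation is \<open>(q, l, r)\<close>, where \<open>l\<close> and \<open>r\<close> are the two halves
  of the tape as integers in base \<open>k\<close>: the least significant digit of \<open>r\<close> is the
  scanned cell, that of \<open>l\<close> the cell immediately to its left.

  Tuples of numbers are coded by the injection \<open>(x, y) \<mapsto> (x + y)\<^sup>2 + x\<close>.
\<close>

definition cpair :: "('a, 'b) struct_scheme \<Rightarrow> 'a \<Rightarrow> 'a \<Rightarrow> 'a" where
  "cpair M x y = ((x \<oplus>\<^bsub>M\<^esub> y) \<otimes>\<^bsub>M\<^esub> (x \<oplus>\<^bsub>M\<^esub> y)) \<oplus>\<^bsub>M\<^esub> x"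

definition ctriple :: "('a, 'b) struct_scheme \<Rightarrow> 'a \<Rightarrow> 'a \<Rightarrow> 'a \<Rightarrow> 'a" where
  "ctriple M x y z = cpair M x (cpair M y z)"

definition ntwo :: "('a, 'b) struct_scheme \<Rightarrow> 'a" where
  "ntwo M = \<one>\<^bsub>M\<^esub> \<oplus>\<^bsub>M\<^esub> \<one>\<^bsub>M\<^esub>"

definition nthree :: "('a, 'b) struct_scheme \<Rightarrow> 'a" where
  "nthree M = ntwo M \<oplus>\<^bsub>M\<^esub> \<one>\<^bsub>M\<^esub>"

text \<open>\<open>d\<close> is the digit of weight \<open>b ^ i\<close> in the base \<open>b\<close> expansion of \<open>t\<close>.\<close>

definition is_digit :: "('a, 'b) struct_scheme \<Rightarrow> 'a \<Rightarrow> 'a \<Rightarrow> 'a \<Rightarrow> 'a \<Rightarrow> bool" where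
  "is_digit M b t i d \<longleftrightarrow> d \<prec>\<^bsub>M\<^esub> b \<and>
     (\<exists>u\<in>nats M. \<exists>v\<in>nats M. v \<prec>\<^bsub>M\<^esub> b \<up>\<^bsub>M\<^esub> i
        \<and> t = ((u \<otimes>\<^bsub>M\<^esub> b) \<oplus>\<^bsub>M\<^esub> d) \<otimes>\<^bsub>M\<^esub> (b \<up>\<^bsub>M\<^esub> i) \<oplus>\<^bsub>M\<^esub> v)"

definition tm_base :: "('a, 'b) struct_scheme \<Rightarrow> 'a \<Rightarrow> 'a \<Rightarrow> 'a" where
  "tm_base M n k = (nthree M \<otimes>\<^bsub>M\<^esub> k) \<otimes>\<^bsub>M\<^esub> (n \<oplus>\<^bsub>M\<^esub> \<one>\<^bsub>M\<^esub>)"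

text \<open>
  \<open>T\<close> is the code of the machine with \<open>n\<close> non-halting states, \<open>k\<close> symbols and table \<open>t\<close>.
  Every \<open>t\<close> below the bound is a legal table, as each number below \<open>3 k (n + 1)\<close> is an
  instruction.
\<close>

definition codes_tm :: "('a, 'b) struct_scheme \<Rightarrow> 'a \<Rightarrow> 'a \<Rightarrow> 'a \<Rightarrow> 'a \<Rightarrow> bool" where
  "codes_tm M T n k t \<longleftrightarrow>
     n \<in> nats M \<and> k \<in> nats M \<and> t \<in> nats M
   \<and> \<zero>\<^bsub>M\<^esub> \<prec>\<^bsub>M\<^esub> n \<and> \<one>\<^bsub>M\<^esub> \<prec>\<^bsub>M\<^esub> k
   \<and> t \<prec>\<^bsub>M\<^esub> tm_base M n k \<up>\<^bsub>M\<^esub> (n \<otimes>\<^bsub>M\<^esub> k)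
   \<and> T = ctriple M n k t"

definition is_tm :: "('a, 'b) struct_scheme \<Rightarrow> 'a \<Rightarrow> bool" where
  "is_tm M T \<longleftrightarrow> (\<exists>n k t. codes_tm M T n k t)"

text \<open>
  \<open>(l', r')\<close> is the tape after writing \<open>a'\<close> on the scanned cell, whose right-hand
  neighbours form \<open>r0\<close>, and making the move \<open>m\<close> (\<open>0\<close>: stay, \<open>1\<close>: left, \<open>2\<close>: right).
\<close>

definition tape_move ::
  "('a, 'b) struct_scheme \<Rightarrow> 'a \<Rightarrow> 'a \<Rightarrow> 'a \<Rightarrow> 'a \<Rightarrow> 'a \<Rightarrow> 'a \<Rightarrow> 'a \<Rightarrow> bool" where
  "tape_move M k m l a' r0 l' r' \<longleftrightarrow>
     (m = \<zero>\<^bsub>M\<^esub> \<and> l' = l \<and> r' = r0 \<otimes>\<^bsub>M\<^esub> k \<oplus>\<^bsub>M\<^esub> a')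
   \<or> (m = \<one>\<^bsub>M\<^esub> \<and> (\<exists>c\<in>nats M. c \<prec>\<^bsub>M\<^esub> k \<and> l = l' \<otimes>\<^bsub>M\<^esub> k \<oplus>\<^bsub>M\<^esub> c
        \<and> r' = (r0 \<otimes>\<^bsub>M\<^esub> k \<oplus>\<^bsub>M\<^esub> a') \<otimes>\<^bsub>M\<^esub> k \<oplus>\<^bsub>M\<^esub> c))
   \<or> (m = ntwo M \<and> l' = l \<otimes>\<^bsub>M\<^esub> k \<oplus>\<^bsub>M\<^esub> a' \<and> r' = r0)"

text \<open>The machine with code \<open>T\<close> passes from the coded state \<open>s\<close> to \<open>s'\<close> in one step.\<close>

definition tm_step :: "('a, 'b) struct_scheme \<Rightarrow> 'a \<Rightarrow> 'a \<Rightarrow> 'a \<Rightarrow> bool" where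
  "tm_step M T s s' \<longleftrightarrow>
     (\<exists>n k t. codes_tm M T n k t \<and>
       (\<exists>q\<in>nats M. \<exists>l\<in>nats M. \<exists>r\<in>nats M. s = ctriple M q l r \<and>
         (q = n \<and> s' = s \<or>
          q \<prec>\<^bsub>M\<^esub> n \<and>
          (\<exists>a\<in>nats M. \<exists>r0\<in>nats M. \<exists>q'\<in>nats M. \<exists>a'\<in>nats M. \<exists>m\<in>nats M.
             a \<prec>\<^bsub>M\<^esub> k \<and> r = r0 \<otimes>\<^bsub>M\<^esub> k \<oplus>\<^bsub>M\<^esub> a
           \<and> (q' \<prec>\<^bsub>M\<^esub> n \<or> q' = n) \<and> a' \<prec>\<^bsub>M\<^esub> k \<and> m \<prec>\<^bsub>M\<^esub> nthree M
           \<and> is_digit M (tm_base M n k) t (q \<otimes>\<^bsub>M\<^esub> k \<oplus>\<^bsub>M\<^esub> a)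
               ((q' \<otimes>\<^bsub>M\<^esub> k \<oplus>\<^bsub>M\<^esub> a') \<otimes>\<^bsub>M\<^esub> nthree M \<oplus>\<^bsub>M\<^esub> m)
           \<and> (\<exists>l'\<in>nats M. \<exists>r'\<in>nats M.
                tape_move M k m l a' r0 l' r' \<and> s' = ctriple M q' l' r')))))"

definition tm_start :: "('a, 'b) struct_scheme \<Rightarrow> 'a" where
  "tm_start M = ctriple M \<zero>\<^bsub>M\<^esub> \<zero>\<^bsub>M\<^esub> \<zero>\<^bsub>M\<^esub>"

text \<open>\<open>tm_run M T z\<close> is \<open>R(T, z)\<close>, computed in \<open>M\<close>, for the machine started on the blank tape.\<close>

definition tm_run :: "('a, 'b) struct_scheme \<Rightarrow> 'a \<Rightarrow> 'a \<Rightarrow> 'a" where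
  "tm_run M T z = (THE s. iterates M (tm_step M T) (tm_start M) z s)"

end

theory Submission
  imports Defs
begin

text \<open>
  The map \<open>f\<close> need not be definable in \<open>V1\<close>, so the claim cannot be proved by an induction on \<open>z\<close>
  inside \<open>V1\<close>; nor is there any induction from outside, as \<open>z\<close> may be nonstandard. Instead, \<open>V1\<close>
  codes the whole computation by one number \<open>c\<close>, the \<open>i\<close>-th state being the digit of weight
  \<open>B ^ i\<close> of \<open>c\<close> in some base \<open>B\<close>. That \<open>d\<close> is such a digit, and that one state follows another, is
  witnessed by equations between sums, products and powers and by inequalities; \<open>f\<close> preserves
  these. Now \<open>V2\<close> shows, by an induction on \<open>i \<le> f z\<close> about \<open>f B\<close> and \<open>f c\<close> only, that its own
  \<open>i\<close>-th state is the \<open>i\<close>-th digit of \<open>f c\<close>: each such \<open>i\<close> is \<open>f j\<close> for some \<open>j \<le> z\<close>, as the range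
  of \<open>f\<close> is an initial segment.
\<close>

section \<open>Definable predicates in models of ZF\<close>

text \<open>The obstacle behind most of the work is that induction inside a model holds only for
  predicates given by a formula with parameters, whereas \<open>omega\<close>, \<open>app\<close>,
  the arithmetic operations and \<open>tm_run\<close> are descriptions in the metalogic. Each must
  be shown to have a definable graph before anything can be proved about it by induction. For the
  same reason an iteration of nonstandard length cannot be built from outside: that it exists, is
  unique and stays in \<open>nats M\<close> are themselves inductions in M. Plain base B digits
  suffice to code a sequence because powers are among the operations that f preserves; with sums and
  products alone a code such as Goedel's beta function would be called for. Digits and steps are
  existential statements, so f carries them from V1 to V2 only. Equality comes from determinism in
  V2: a digit at a given place and the successor of a given state are unique there. This requires a
  total and deterministic step relation, which holds on codes of genuine states only and is the
  reason for the invariant that accompanies iterations.\<close>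

text \<open>Supplies fresh variables for \<open>sat_rename\<close>: environments are total
  functions, but a formula looks at finitely many of their values.\<close>

lemma sat_depends_on_finite:
  "\<exists>F. finite F \<and> (\<forall>e e'. (\<forall>i\<in>F. e i = e' i) \<longrightarrow> sat M e p = sat M e' p)"
proof (induction p)
  case (Member i j) show ?case by (rule exI[of _ "{i,j}"]) auto
next
  case (Equal i j) show ?case by (rule exI[of _ "{i,j}"]) auto
next
  case (Neg p) then show ?case by auto
next
  case (Conj p q)
  then obtain F F' where "finite F" "finite F'"
    "\<forall>e e'. (\<forall>i\<in>F. e i = e' i) \<longrightarrow> sat M e p = sat M e' p"
    "\<forall>e e'. (\<forall>i\<in>F'. e i = e' i) \<longrightarrow> sat M e q = sat M e' q" by auto
  then show ?case by (intro exI[of _ "F \<union> F'"]) (simp, blast)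
next
  case (Forall k p)
  then obtain F where F: "finite F" "\<And>e e'. (\<forall>i\<in>F. e i = e' i) \<Longrightarrow> sat M e p = sat M e' p" by blast
  have "sat M (e(k:=x)) p = sat M (e'(k:=x)) p" if "\<forall>i\<in>F. e i = e' i" for e e' x
    using that by (intro F(2)) auto
  then have "sat M e (Forall k p) = sat M e' (Forall k p)" if "\<forall>i\<in>F. e i = e' i" for e e'
    unfolding sat.simps by (intro ball_cong refl) (simp add: that)
  with F(1) show ?case by (intro exI[of _ F] conjI allI impI)
qed

lemma sat_rename: "\<exists>p'. \<forall>e. sat M e p' = sat M (\<lambda>i. e (\<rho> i)) p"
proof (induction p arbitrary: \<rho>)
  case (Member i j) show ?case by (rule exI[of _ "Member (\<rho> i) (\<rho> j)"]) auto
next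
  case (Equal i j) show ?case by (rule exI[of _ "Equal (\<rho> i) (\<rho> j)"]) auto
next
  case (Neg p) then obtain p' where "\<forall>e. sat M e p' = sat M (\<lambda>i. e (\<rho> i)) p" by blast
  then show ?case by (intro exI[of _ "Neg p'"]) auto
next
  case (Conj p q)
  obtain p' where "\<forall>e. sat M e p' = sat M (\<lambda>i. e (\<rho> i)) p" using Conj by blast
  moreover obtain q' where "\<forall>e. sat M e q' = sat M (\<lambda>i. e (\<rho> i)) q" using Conj by blast
  ultimately show ?case by (intro exI[of _ "Conj p' q'"]) auto
next
  case (Forall j p)
  obtain F where F: "finite F" "\<And>e e'. (\<forall>i\<in>F. e i = e' i) \<Longrightarrow> sat M e p = sat M e' p"
    using sat_depends_on_finite[of M p] by blast
  \<comment> \<open>The new bound variable lies outside the image of all variables that matter in p,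
    so nothing is captured, even by a renaming that is not injective. The induction hypothesis is
    applied to the renaming updated at j.\<close>
  obtain k where k: "k \<notin> \<rho> ` F" using F(1) by (meson finite_imageI ex_new_if_finite infinite_UNIV_nat)
  obtain p' where p': "\<forall>e. sat M e p' = sat M (\<lambda>i. e ((\<rho>(j := k)) i)) p" using Forall by blast
  have "sat M (e(k := x)) p' = sat M ((\<lambda>i. e (\<rho> i))(j := x)) p" for e x
    unfolding p'[rule_format] using k by (intro F(2)) auto
  then show ?case by (intro exI[of _ "Forall k p'"]) auto
qed

text \<open>Variables with even numbers hold the environment \<open>e\<close>, those with odd numbers the parameters \<open>c\<close>.\<close>

definition mix :: "(nat \<Rightarrow> 'a) \<Rightarrow> (nat \<Rightarrow> 'a) \<Rightarrow> nat \<Rightarrow> 'a" where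
  "mix e c i = (if even i then e (i div 2) else c (i div 2))"

lemma mix_simps [simp]: "mix e c (2 * i) = e i" "mix e c (Suc (2 * i)) = c i"
  by (simp_all add: mix_def)

lemma mix_0: "mix e c 0 = e 0"
  by (simp add: mix_def)

lemma range_case_nat: "x \<in> D \<Longrightarrow> range e \<subseteq> D \<Longrightarrow> range (case_nat x e) \<subseteq> D"
  unfolding image_subset_iff by (simp split: nat.split)

lemma mix_eqI: "(\<And>i. g (2 * i) = e i) \<Longrightarrow> (\<And>i. g (Suc (2 * i)) = c i) \<Longrightarrow> g = mix e c"
  unfolding mix_def fun_eq_iff by (metis odd_two_times_div_two_succ even_two_times_div_two Suc_eq_plus1)

text \<open>The parameters are chosen once for all environments, and the formula has to be right
  only for environments with values in D. Typically D is \<open>dom M\<close> or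
  \<open>nats M\<close>.\<close>

definition definable :: "('a, 'b) struct_scheme \<Rightarrow> 'a set \<Rightarrow> ((nat \<Rightarrow> 'a) \<Rightarrow> bool) \<Rightarrow> bool" where
  "definable M D P \<longleftrightarrow> (\<exists>p c. range c \<subseteq> dom M \<and>
     (\<forall>e. range e \<subseteq> D \<longrightarrow> P e = sat M (mix e c) p))"

text \<open>The language has no function symbols, so a term is handled through its graph. Closure
  under D allows its value to be quantified over D.\<close>

definition definable_term :: "('a, 'b) struct_scheme \<Rightarrow> 'a set \<Rightarrow> ((nat \<Rightarrow> 'a) \<Rightarrow> 'a) \<Rightarrow> bool" where
  "definable_term M D t \<longleftrightarrow> (\<forall>e. range e \<subseteq> D \<longrightarrow> t e \<in> D) \<and>
     definable M D (\<lambda>e. e 0 = t (\<lambda>i. e (Suc i)))"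

text \<open>These are ranges for which membership in D can itself be written as a formula, if
  necessary with the set d as a parameter.\<close>

definition quantifier_range :: "('a, 'b) struct_scheme \<Rightarrow> 'a set \<Rightarrow> bool" where
  "quantifier_range M D \<longleftrightarrow> D = dom M \<or> (\<exists>d\<in>dom M. D = {x \<in> dom M. x \<epsilon>\<^bsub>M\<^esub> d})"

section \<open>Closure properties of definability\<close>

lemma definable_cong:
  "definable M D P \<Longrightarrow> (\<And>e. range e \<subseteq> D \<Longrightarrow> P e = Q e) \<Longrightarrow> definable M D Q"
  unfolding definable_def by auto

lemma definable_mono: "definable M D P \<Longrightarrow> D' \<subseteq> D \<Longrightarrow> definable M D' P"
  unfolding definable_def by (meson order_trans)

lemma definable_rename:
  assumes "definable M D P" shows "definable M D (\<lambda>e. P (\<lambda>i. e (\<rho> i)))"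
proof -
  obtain p c where p: "range c \<subseteq> dom M" "\<And>e. range e \<subseteq> D \<Longrightarrow> P e = sat M (mix e c) p"
    using assms unfolding definable_def by blast
  obtain p' where p': "\<And>e. sat M e p' = sat M (\<lambda>i. e (mix (\<lambda>i. 2 * \<rho> i) (\<lambda>i. Suc (2 * i)) i)) p"
    using sat_rename by metis
  have "(\<lambda>i. mix e c (mix (\<lambda>i. 2 * \<rho> i) (\<lambda>i. Suc (2 * i)) i)) = mix (\<lambda>i. e (\<rho> i)) c" for e
    by (rule mix_eqI) auto
  then have "P (\<lambda>i. e (\<rho> i)) = sat M (mix e c) p'" if "range e \<subseteq> D" for e
    unfolding p' using that by (subst p(2)) auto
  then show ?thesis unfolding definable_def using p(1) by blast
qed

lemma definable_neg:
  assumes "definable M D P" shows "definable M D (\<lambda>e. \<not> P e)"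
proof -
  obtain p c where "range c \<subseteq> dom M" "\<And>e. range e \<subseteq> D \<Longrightarrow> P e = sat M (mix e c) p"
    using assms unfolding definable_def by blast
  then show ?thesis unfolding definable_def by (intro exI[of _ "Neg p"] exI[of _ c]) auto
qed

lemma definable_conj:
  assumes "definable M D P" "definable M D Q" shows "definable M D (\<lambda>e. P e \<and> Q e)"
proof -
  obtain p c where p: "range c \<subseteq> dom M" "\<And>e. range e \<subseteq> D \<Longrightarrow> P e = sat M (mix e c) p"
    using assms unfolding definable_def by blast
  obtain q d where q: "range d \<subseteq> dom M" "\<And>e. range e \<subseteq> D \<Longrightarrow> Q e = sat M (mix e d) q"
    using assms unfolding definable_def by blast
  \<comment> \<open>The two formulas come with different parameter sequences. They are interleaved
    into \<open>mix c d\<close>, and the odd variables of each formula are redirected to its own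
    half.\<close>
  obtain p' where p': "\<And>e. sat M e p' = sat M (\<lambda>i. e (mix (\<lambda>i. 2 * i) (\<lambda>i. Suc (2 * (2 * i))) i)) p"
    using sat_rename by metis
  obtain q' where q': "\<And>e. sat M e q' = sat M (\<lambda>i. e (mix (\<lambda>i. 2 * i) (\<lambda>i. Suc (2 * (Suc (2 * i)))) i)) q"
    using sat_rename by metis
  have "(\<lambda>i. mix e (mix c d) (mix (\<lambda>i. 2 * i) (\<lambda>i. Suc (2 * (2 * i))) i)) = mix e c" for e
    by (rule mix_eqI) (auto simp only: mix_simps)
  moreover have "(\<lambda>i. mix e (mix c d) (mix (\<lambda>i. 2 * i) (\<lambda>i. Suc (2 * (Suc (2 * i)))) i)) = mix e d" for e
    by (rule mix_eqI) (auto simp only: mix_simps)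
  ultimately have "\<forall>e. range e \<subseteq> D \<longrightarrow> (P e \<and> Q e) = sat M (mix e (mix c d)) (Conj p' q')"
    using p(2) q(2) by (simp add: p' q')
  moreover have "range (mix c d) \<subseteq> dom M" using p(1) q(1) by (auto simp: mix_def)
  ultimately show ?thesis unfolding definable_def by blast
qed

lemma definable_disj: "definable M D P \<Longrightarrow> definable M D Q \<Longrightarrow> definable M D (\<lambda>e. P e \<or> Q e)"
  by (rule definable_cong[OF definable_neg[OF definable_conj[OF definable_neg definable_neg]]]) auto

lemma definable_imp: "definable M D P \<Longrightarrow> definable M D Q \<Longrightarrow> definable M D (\<lambda>e. P e \<longrightarrow> Q e)"
  by (rule definable_cong[OF definable_disj[OF definable_neg]]) auto

lemma definable_iff: "definable M D P \<Longrightarrow> definable M D Q \<Longrightarrow> definable M D (\<lambda>e. P e \<longleftrightarrow> Q e)"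
  by (rule definable_cong[OF definable_conj[OF definable_imp[of M D P Q] definable_imp[of M D Q P]]]) auto

text \<open>
  The rules for quantifiers and terms are stated so that resolution with them traverses a
  predicate of the form \<open>\<lambda>e. \<dots>\<close>: a bound variable becomes number \<open>0\<close> of the environment.
\<close>

lemma definable_ball:
  assumes D: "quantifier_range M D" and P: "definable M D (\<lambda>e. P (e 0) (\<lambda>i. e (Suc i)))"
  shows "definable M D (\<lambda>e. \<forall>x\<in>D. P x e)"
proof -
  obtain p c where p: "range c \<subseteq> dom M"
      "\<And>e. range e \<subseteq> D \<Longrightarrow> P (e 0) (\<lambda>i. e (Suc i)) = sat M (mix e c) p"
    using P unfolding definable_def by blast
  \<comment> \<open>The body expects the bound value in variable 0 and \<open>e i\<close> in
    variable 2 (i + 1). The value moves to variable 1, the first parameter slot, so that the even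
    variables hold e again; the parameters move up by two slots, to make room for the value and for
    d in variable 3.\<close>
  let ?\<rho> = "mix (case_nat 1 (\<lambda>i. 2 * i)) (\<lambda>i. Suc (2 * (Suc (Suc i))))"
  obtain p' where p': "\<And>e. sat M e p' = sat M (\<lambda>i. e (?\<rho> i)) p"
    using sat_rename by metis
  \<comment> \<open>g is the guard "variable 1 lies in D". For D = \<open>dom M\<close> it is a
    tautology and d an arbitrary element.\<close>
  obtain g d where gd: "d \<in> dom M" "\<And>e. e 1 \<in> dom M \<Longrightarrow> e 3 = d \<Longrightarrow> sat M e g = (e 1 \<in> D)"
  proof (cases "D = dom M")
    case True
    then show ?thesis using p(1) by (intro that[of "c 0" "Equal 0 0"]) auto
  next
    case False
    then obtain d where "d \<in> dom M" "D = {x \<in> dom M. x \<epsilon>\<^bsub>M\<^esub> d}"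
      using D unfolding quantifier_range_def by blast
    then show ?thesis by (intro that[of d "Member 1 3"]) auto
  qed
  define c' where "c' = case_nat d (case_nat d c)"
  have DM: "D \<subseteq> dom M" using D unfolding quantifier_range_def by blast
  have upd: "(mix e c')(1 := x) = mix e (case_nat x (case_nat d c))" for e x
    by (rule mix_eqI) (auto simp: c'_def mix_def split: nat.split)
  have ren: "(\<lambda>i. mix e (case_nat x (case_nat d c)) (?\<rho> i)) = mix (case_nat x e) c" for e x
  proof (rule mix_eqI)
    fix i
    show "mix e (case_nat x (case_nat d c)) (?\<rho> (2 * i)) = (case i of 0 \<Rightarrow> x | Suc j \<Rightarrow> e j)"
      using mix_simps(2)[of e "case_nat x (case_nat d c)" 0]
      by (cases i) (simp_all only: mix_simps nat.case One_nat_def mult_0_right mix_0)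
    show "mix e (case_nat x (case_nat d c)) (?\<rho> (Suc (2 * i))) = c i"
      by (simp only: mix_simps nat.case)
  qed
  have 1: "mix e (case_nat x (case_nat d c)) 1 = x" "mix e (case_nat x (case_nat d c)) 3 = d" for e x
    using mix_simps(2)[of e "case_nat x (case_nat d c)" 0] mix_simps(2)[of e "case_nat x (case_nat d c)" 1]
    by (simp_all add: numeral_3_eq_3)
  have "(\<forall>x\<in>D. P x e) = sat M (mix e c') (Forall 1 (Neg (Conj g (Neg p'))))" if e: "range e \<subseteq> D" for e
  proof -
    have "P x e = sat M (mix (case_nat x e) c) p" if "x \<in> D" for x
    proof -
      have "range (case_nat x e) \<subseteq> D" using that e by (rule range_case_nat)
      from p(2)[OF this] show ?thesis by simp
    qed
    moreover have "sat M (mix e (case_nat x (case_nat d c))) g = (x \<in> D)" if "x \<in> dom M" for x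
      using gd(2)[of "mix e (case_nat x (case_nat d c))"] that 1[of e x] by simp
    ultimately show ?thesis using DM unfolding sat.simps upd p' ren by blast
  qed
  moreover have "range c' \<subseteq> dom M" unfolding c'_def by (intro range_case_nat gd(1) p(1))
  ultimately show ?thesis unfolding definable_def by blast
qed

lemma definable_bex:
  assumes D: "quantifier_range M D" and P: "definable M D (\<lambda>e. P (e 0) (\<lambda>i. e (Suc i)))"
  shows "definable M D (\<lambda>e. \<exists>x\<in>D. P x e)"
  by (rule definable_cong[OF definable_neg[OF definable_ball[OF D definable_neg[OF P]]]]) auto

lemma definable_term_closed: "definable_term M D t \<Longrightarrow> range e \<subseteq> D \<Longrightarrow> t e \<in> D"
  by (simp add: definable_term_def)

lemma definable_graph:
  assumes "definable_term M D t" shows "definable M D (\<lambda>e. e i = t (\<lambda>j. e (\<rho> j)))"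
  using definable_rename[of M D "\<lambda>e. e 0 = t (\<lambda>i. e (Suc i))" "case_nat i \<rho>"] assms
  by (simp add: definable_term_def)


section \<open>Models of ZF: use of the axioms, and substitution of definable terms\<close>

locale zf =
  fixes M :: "('a, 'b) struct_scheme" (structure)
  assumes ZF: "ZF_model M"
begin

lemmas ZF_axioms = ZF[unfolded ZF_model_def]

lemma ext: "x \<in> dom M \<Longrightarrow> y \<in> dom M \<Longrightarrow> (\<And>z. z \<in> dom M \<Longrightarrow> z \<epsilon> x \<longleftrightarrow> z \<epsilon> y) \<Longrightarrow> x = y"
  using ZF_axioms[THEN conjunct1] by simp

lemma pairing: "x \<in> dom M \<Longrightarrow> y \<in> dom M \<Longrightarrow> \<exists>u\<in>dom M. \<forall>z\<in>dom M. z \<epsilon> u \<longleftrightarrow> z = x \<or> z = y"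
  using ZF_axioms[THEN conjunct2, THEN conjunct2, THEN conjunct1] by simp

lemma union: "x \<in> dom M \<Longrightarrow> \<exists>u\<in>dom M. \<forall>z\<in>dom M. z \<epsilon> u \<longleftrightarrow> (\<exists>y\<in>dom M. z \<epsilon> y \<and> y \<epsilon> x)"
  using ZF_axioms[THEN conjunct2, THEN conjunct2, THEN conjunct2, THEN conjunct1] by simp

lemma infinity: "\<exists>w\<in>dom M. inductive_in M w"
  using ZF_axioms[THEN conjunct2, THEN conjunct2, THEN conjunct2, THEN conjunct2, THEN conjunct2, THEN conjunct1] by simp

lemma separation_sat:
  "range e \<subseteq> dom M \<Longrightarrow> x \<in> dom M \<Longrightarrow>
    \<exists>u\<in>dom M. \<forall>z\<in>dom M. z \<epsilon> u \<longleftrightarrow> z \<epsilon> x \<and> sat M (e(0 := z)) p"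
  using ZF_axioms[THEN conjunct2, THEN conjunct2, THEN conjunct2, THEN conjunct2, THEN conjunct2, THEN conjunct2, THEN conjunct1] by simp

text \<open>Even a formula without parameters comes with a parameter sequence, whose values must be
  elements of M.\<close>

lemma dom_nonempty: "\<exists>x. x \<in> dom M" using infinity by blast

lemma definable_var_eq: "definable M D (\<lambda>e. e i = e j)"
  unfolding definable_def using dom_nonempty
  by (intro exI[of _ "Equal (2 * i) (2 * j)"] exI[of _ "\<lambda>_. SOME x. x \<in> dom M"])
    (auto intro: someI_ex)

lemma definable_var_mem: "definable M D (\<lambda>e. e i \<epsilon> e j)"
  unfolding definable_def using dom_nonempty
  by (intro exI[of _ "Member (2 * i) (2 * j)"] exI[of _ "\<lambda>_. SOME x. x \<in> dom M"])
    (auto intro: someI_ex)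

lemma definable_term_var: "definable_term M D (\<lambda>e. e i)"
  unfolding definable_term_def using definable_var_eq by blast

lemma definable_term_const: "c \<in> D \<Longrightarrow> quantifier_range M D \<Longrightarrow> definable_term M D (\<lambda>e. c)"
  unfolding definable_term_def definable_def
  by (intro conjI exI[of _ "Equal 0 1"] exI[of _ "\<lambda>_. c"])
    (auto simp: mix_def quantifier_range_def)

text \<open>A term is substituted by quantifying over its value; closure of the term under D
  provides the witness.\<close>

lemma definable_subst:
  assumes "quantifier_range M D" "definable M D (\<lambda>e. P (e 0) (\<lambda>i. e (Suc i)))" "definable_term M D t"
  shows "definable M D (\<lambda>e. P (t e) e)"
proof -
  have "definable M D (\<lambda>e. \<exists>x\<in>D. x = t e \<and> P x e)"
    by (intro definable_bex definable_conj assms definable_graph)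
  then show ?thesis
    by (rule definable_cong) (use definable_term_closed[OF assms(3)] in auto)
qed

lemma definable_subst2:
  assumes D: "quantifier_range M D" and R: "definable M D (\<lambda>e. R (e 0) (e 1))"
    and st: "definable_term M D s" "definable_term M D t"
  shows "definable M D (\<lambda>e. R (s e) (t e))"
proof -
  have "definable M D (\<lambda>e. \<exists>x\<in>D. \<exists>y\<in>D. x = s e \<and> y = t e \<and> R x y)"
    \<comment> \<open>The innermost quantifier binds number 0, so y is number 0 and x number 1; the
      renaming restores the order.\<close>
    using definable_rename[OF R, of "\<lambda>i. if i = 0 then 1 else 0"]
    by (intro definable_bex definable_conj D st definable_graph) simp
  then show ?thesis
    by (rule definable_cong) (use st[THEN definable_term_closed] in auto)
qed

lemma definable_subst3:
  assumes D: "quantifier_range M D" and R: "definable M D (\<lambda>e. R (e 0) (e 1) (e 2))"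
    and stu: "definable_term M D s" "definable_term M D t" "definable_term M D u"
  shows "definable M D (\<lambda>e. R (s e) (t e) (u e))"
proof -
  have "definable M D (\<lambda>e. \<exists>x\<in>D. \<exists>y\<in>D. \<exists>z\<in>D. x = s e \<and> y = t e \<and> z = u e \<and> R x y z)"
    using definable_rename[OF R, of "\<lambda>i. 2 - i"]
    by (intro definable_bex definable_conj D stu definable_graph) (simp add: numeral_2_eq_2)
  then show ?thesis
    by (rule definable_cong) (use stu[THEN definable_term_closed] in auto)
qed

lemma definable_term_rename:
  assumes "definable_term M D t" shows "definable_term M D (\<lambda>e. t (\<lambda>i. e (\<rho> i)))"
  unfolding definable_term_def
proof (intro conjI allI impI)
  show "t (\<lambda>i. e (\<rho> i)) \<in> D" if "range e \<subseteq> D" for e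
    using that by (intro definable_term_closed[OF assms]) auto
  show "definable M D (\<lambda>e. e 0 = t (\<lambda>i. e (Suc (\<rho> i))))"
    by (rule definable_graph[OF assms])
qed

lemma definable_term_app2:
  assumes D: "quantifier_range M D" and F: "\<And>x y. x \<in> D \<Longrightarrow> y \<in> D \<Longrightarrow> F x y \<in> D"
    and G: "definable M D (\<lambda>e. e 0 = F (e 1) (e 2))"
    and st: "definable_term M D s" "definable_term M D t"
  shows "definable_term M D (\<lambda>e. F (s e) (t e))"
  unfolding definable_term_def
  using F st[THEN definable_term_closed] definable_subst3[OF D G definable_term_var
      st[THEN definable_term_rename]]
  by blast

lemma definable_term_app1:
  assumes D: "quantifier_range M D" and F: "\<And>x. x \<in> D \<Longrightarrow> F x \<in> D"
    and G: "definable M D (\<lambda>e. e 0 = F (e 1))" and t: "definable_term M D t"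
  shows "definable_term M D (\<lambda>e. F (t e))"
  unfolding definable_term_def
  using F t[THEN definable_term_closed]
    definable_subst2[OF D G definable_term_var t[THEN definable_term_rename]]
  by blast

lemma definable_eq:
  "quantifier_range M D \<Longrightarrow> definable_term M D s \<Longrightarrow> definable_term M D t \<Longrightarrow> definable M D (\<lambda>e. s e = t e)"
  by (rule definable_subst2[where R = "(=)", OF _ definable_var_eq])

lemma definable_mem:
  "quantifier_range M D \<Longrightarrow> definable_term M D s \<Longrightarrow> definable_term M D t \<Longrightarrow> definable M D (\<lambda>e. s e \<epsilon> t e)"
  by (rule definable_subst2[where R = "(\<epsilon>)", OF _ definable_var_mem])

lemma quantifier_range_dom: "quantifier_range M (dom M)"
  by (simp add: quantifier_range_def)

text \<open>P sees only \<open>e 0\<close>, so all environment variables are merged into variable 0,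
  the one that the axiom reserves for the element tested, and the parameters move up by one. D may
  be smaller than \<open>dom M\<close> as long as it covers the members of d.\<close>

lemma separation:
  assumes P: "definable M D (\<lambda>e. P (e 0))" and d: "d \<in> dom M"
    and D: "\<And>z. z \<in> dom M \<Longrightarrow> z \<epsilon> d \<Longrightarrow> z \<in> D"
  shows "\<exists>u\<in>dom M. \<forall>z\<in>dom M. z \<epsilon> u \<longleftrightarrow> z \<epsilon> d \<and> P z"
proof -
  obtain p c where p: "range c \<subseteq> dom M" "\<And>e. range e \<subseteq> D \<Longrightarrow> P (e 0) = sat M (mix e c) p"
    using P unfolding definable_def by blast
  obtain p' where p': "\<And>e. sat M e p' = sat M (\<lambda>i. e (mix (\<lambda>_. 0) Suc i)) p"
    using sat_rename by metis
  have "(\<lambda>i. ((case_nat x c)(0 := z)) (mix (\<lambda>_. 0) Suc i)) = mix (\<lambda>_. z) c" for x z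
    by (rule mix_eqI) auto
  then have "sat M ((case_nat d c)(0 := z)) p' = P z" if "z \<in> D" for z
    using p(2)[of "\<lambda>_. z"] that by (simp add: p')
  moreover have "range (case_nat d c) \<subseteq> dom M" using d p(1) by (rule range_case_nat)
  ultimately show ?thesis using separation_sat[of "case_nat d c" d p'] d D by metis
qed

lemmas definable_rules = definable_neg definable_conj definable_disj definable_imp definable_iff
  definable_ball definable_bex definable_eq definable_mem definable_term_var definable_term_const
  quantifier_range_dom

subsection \<open>Natural numbers\<close>

lemma ex_empty: "\<exists>x. is_empty M x"
  using infinity unfolding inductive_in_def by blast

lemma is_empty_unique: "is_empty M x \<Longrightarrow> is_empty M y \<Longrightarrow> x = y"
  unfolding is_empty_def by (intro ext) auto

lemma is_empty_vempty: "is_empty M (vempty M)"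
  unfolding vempty_def using ex_empty is_empty_unique by (intro theI'[of "is_empty M"] ex_ex1I) simp_all

lemma vempty: "vempty M \<in> dom M" "z \<in> dom M \<Longrightarrow> \<not> z \<epsilon> vempty M"
  using is_empty_vempty by (auto simp: is_empty_def)

lemma is_empty_iff: "is_empty M x \<longleftrightarrow> x = vempty M"
  using is_empty_unique is_empty_vempty by blast

lemma upair:
  assumes "x \<in> dom M" "y \<in> dom M"
  shows "upair M x y \<in> dom M" "z \<in> dom M \<Longrightarrow> z \<epsilon> upair M x y \<longleftrightarrow> z = x \<or> z = y"
proof -
  obtain u where u: "u \<in> dom M" "\<forall>z\<in>dom M. z \<epsilon> u \<longleftrightarrow> z = x \<or> z = y" using pairing assms by blast
  then have "upair M x y = u" unfolding upair_def by (intro the_equality conjI ext) auto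
  then show "upair M x y \<in> dom M" "z \<in> dom M \<Longrightarrow> z \<epsilon> upair M x y \<longleftrightarrow> z = x \<or> z = y" using u by auto
qed

lemma opair_dom: "x \<in> dom M \<Longrightarrow> y \<in> dom M \<Longrightarrow> opair M x y \<in> dom M"
  unfolding opair_def by (simp add: upair)

lemma upair_inj:
  assumes "x \<in> dom M" "y \<in> dom M" "x' \<in> dom M" "y' \<in> dom M" "upair M x y = upair M x' y'"
  shows "x = x' \<and> y = y' \<or> x = y' \<and> y = x'"
  using upair(2)[OF assms(1,2), of x] upair(2)[OF assms(1,2), of y] upair(2)[OF assms(1,2), of x']
    upair(2)[OF assms(1,2), of y'] upair(2)[OF assms(3,4), of x] upair(2)[OF assms(3,4), of y]
    upair(2)[OF assms(3,4), of x'] upair(2)[OF assms(3,4), of y'] assms by auto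

lemma opair_inj:
  assumes "x \<in> dom M" "y \<in> dom M" "x' \<in> dom M" "y' \<in> dom M"
  shows "opair M x y = opair M x' y' \<longleftrightarrow> x = x' \<and> y = y'"
proof
  assume "opair M x y = opair M x' y'"
  then have "upair M x x = upair M x' x' \<and> upair M x y = upair M x' y'
     \<or> upair M x x = upair M x' y' \<and> upair M x y = upair M x' x'"
    unfolding opair_def using assms by (intro upair_inj upair(1))
  then show "x = x' \<and> y = y'"
    using upair_inj[of x x x' x'] upair_inj[of x y x' y'] upair_inj[of x x x' y'] upair_inj[of x y x' x']
      assms by auto
qed auto

text \<open>The union of {x, {y}}. It yields both successors and the extension of a history by one
  pair.\<close>

lemma ex_adjoin:
  assumes "x \<in> dom M" "y \<in> dom M"
  shows "\<exists>u\<in>dom M. \<forall>z\<in>dom M. z \<epsilon> u \<longleftrightarrow> z \<epsilon> x \<or> z = y"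
proof -
  have "upair M y y \<in> dom M" "upair M x (upair M y y) \<in> dom M" using assms by (auto simp: upair)
  then obtain u where "u \<in> dom M"
    "\<forall>z\<in>dom M. z \<epsilon> u \<longleftrightarrow> (\<exists>v\<in>dom M. z \<epsilon> v \<and> v \<epsilon> upair M x (upair M y y))"
    using union by blast
  moreover from this have "z \<epsilon> u \<longleftrightarrow> z \<epsilon> x \<or> z \<epsilon> upair M y y" if "z \<in> dom M" for z
    using that assms upair(1)[of y y] upair(2)[of x "upair M y y"] by blast
  ultimately show ?thesis using assms by (intro bexI[of _ u]) (simp_all add: upair)
qed

lemma is_succ_unique: "is_succ M x s \<Longrightarrow> is_succ M x s' \<Longrightarrow> s = s'"
  unfolding is_succ_def by (intro ext) auto

lemma is_succ_vsucc: "x \<in> dom M \<Longrightarrow> is_succ M x (vsucc M x)"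
  unfolding vsucc_def using is_succ_unique ex_adjoin[of x x]
  by (intro theI'[of "is_succ M x"] ex_ex1I) (auto simp: is_succ_def)

lemma vsucc:
  "x \<in> dom M \<Longrightarrow> vsucc M x \<in> dom M"
  "x \<in> dom M \<Longrightarrow> z \<in> dom M \<Longrightarrow> z \<epsilon> vsucc M x \<longleftrightarrow> z \<epsilon> x \<or> z = x"
  using is_succ_vsucc unfolding is_succ_def by auto

lemma is_succ_iff: "x \<in> dom M \<Longrightarrow> is_succ M x s \<longleftrightarrow> s = vsucc M x"
  using is_succ_unique is_succ_vsucc by blast

lemma inductive_in_iff:
  "inductive_in M w \<longleftrightarrow> w \<in> dom M \<and> vempty M \<epsilon> w \<and> (\<forall>x\<in>dom M. x \<epsilon> w \<longrightarrow> vsucc M x \<epsilon> w)"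
  unfolding inductive_in_def by (auto simp: is_empty_iff is_succ_iff vempty vsucc)

text \<open>Extensionality turns the description into a first-order condition on members, which
  defines the graph.\<close>

lemma definable_term_vsucc:
  "definable_term M (dom M) t \<Longrightarrow> definable_term M (dom M) (\<lambda>e. vsucc M (t e))"
proof (rule definable_term_app1[OF quantifier_range_dom vsucc(1)])
  have "definable M (dom M) (\<lambda>e. \<forall>z\<in>dom M. z \<epsilon> e 0 \<longleftrightarrow> z \<epsilon> e 1 \<or> z = e 1)"
    by (intro definable_rules)
  then show "definable M (dom M) (\<lambda>e. e 0 = vsucc M (e 1))"
  proof (rule definable_cong)
    fix e :: "nat \<Rightarrow> 'a" assume "range e \<subseteq> dom M"
    then have "e 0 \<in> dom M" "e 1 \<in> dom M" by auto
    then show "(\<forall>z\<in>dom M. z \<epsilon> e 0 \<longleftrightarrow> z \<epsilon> e 1 \<or> z = e 1) = (e 0 = vsucc M (e 1))"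
      by (intro iffI ext) (simp_all add: vsucc)
  qed
qed

lemma definable_term_upair:
  "definable_term M (dom M) s \<Longrightarrow> definable_term M (dom M) t \<Longrightarrow>
    definable_term M (dom M) (\<lambda>e. upair M (s e) (t e))"
proof (rule definable_term_app2[OF quantifier_range_dom upair(1)])
  have "definable M (dom M) (\<lambda>e. \<forall>z\<in>dom M. z \<epsilon> e 0 \<longleftrightarrow> z = e 1 \<or> z = e 2)"
    by (intro definable_rules)
  then show "definable M (dom M) (\<lambda>e. e 0 = upair M (e 1) (e 2))"
  proof (rule definable_cong)
    fix e :: "nat \<Rightarrow> 'a" assume "range e \<subseteq> dom M"
    then have "e 0 \<in> dom M" "e 1 \<in> dom M" "e 2 \<in> dom M" by auto
    then show "(\<forall>z\<in>dom M. z \<epsilon> e 0 \<longleftrightarrow> z = e 1 \<or> z = e 2) = (e 0 = upair M (e 1) (e 2))"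
      by (intro iffI ext) (simp_all add: upair)
  qed
qed

lemma definable_term_opair:
  "definable_term M (dom M) s \<Longrightarrow> definable_term M (dom M) t \<Longrightarrow>
    definable_term M (dom M) (\<lambda>e. opair M (s e) (t e))"
  unfolding opair_def by (intro definable_term_upair)

text \<open>The intersection of all inductive sets, separated from one of them. Inductive sets are
  elements of M, so the intersection is over a quantifier that a formula can express.\<close>

lemma omega_least:
  "inductive_in M (omega M) \<and> (\<forall>u. inductive_in M u \<longrightarrow> (\<forall>x\<in>dom M. x \<epsilon> omega M \<longrightarrow> x \<epsilon> u))"
proof -
  obtain w where w: "inductive_in M w" using infinity by blast
  \<comment> \<open>The condition \<open>u \<in> dom M\<close> is repeated so that the formula folds
    back by \<open>inductive_in_iff\<close>.\<close>
  have "definable M (dom M) (\<lambda>e. \<forall>u\<in>dom M. u \<in> dom M \<and>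
      vempty M \<epsilon> u \<and> (\<forall>x\<in>dom M. x \<epsilon> u \<longrightarrow> vsucc M x \<epsilon> u) \<longrightarrow> e 0 \<epsilon> u)"
  proof (rule definable_cong)
    show "definable M (dom M) (\<lambda>e. \<forall>u\<in>dom M.
      vempty M \<epsilon> u \<and> (\<forall>x\<in>dom M. x \<epsilon> u \<longrightarrow> vsucc M x \<epsilon> u) \<longrightarrow> e 0 \<epsilon> u)"
      by (intro definable_rules definable_term_vsucc vempty)
  qed auto
  then have "definable M (dom M) (\<lambda>e. \<forall>u\<in>dom M. inductive_in M u \<longrightarrow> e 0 \<epsilon> u)"
    by (simp only: inductive_in_iff)
  moreover have "w \<in> dom M" using w by (simp add: inductive_in_iff)
  ultimately have "\<exists>v\<in>dom M. \<forall>z\<in>dom M. z \<epsilon> v \<longleftrightarrow>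
      z \<epsilon> w \<and> (\<forall>u\<in>dom M. inductive_in M u \<longrightarrow> z \<epsilon> u)"
    by (rule separation) simp
  then obtain v where v: "v \<in> dom M"
    "\<forall>z\<in>dom M. z \<epsilon> v \<longleftrightarrow> z \<epsilon> w \<and> (\<forall>u\<in>dom M. inductive_in M u \<longrightarrow> z \<epsilon> u)"
    by blast
  then have mem_v: "z \<epsilon> v \<longleftrightarrow> z \<epsilon> w \<and> (\<forall>u. inductive_in M u \<longrightarrow> z \<epsilon> u)" if "z \<in> dom M" for z
    using that inductive_in_iff by auto
  have v_ind: "inductive_in M v"
    unfolding inductive_in_iff
  proof (intro conjI ballI impI)
    show "vempty M \<epsilon> v" using w by (simp add: mem_v vempty(1)) (simp add: inductive_in_iff)
    fix x assume x: "x \<in> dom M" "x \<epsilon> v"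
    have "vsucc M x \<epsilon> u" if "inductive_in M u" for u
      using that x mem_v[of x] by (simp add: inductive_in_iff[of u])
    then show "vsucc M x \<epsilon> v" using w x by (simp add: mem_v vsucc(1))
  qed (rule v(1))
  have v_least: "\<forall>u. inductive_in M u \<longrightarrow> (\<forall>x\<in>dom M. x \<epsilon> v \<longrightarrow> x \<epsilon> u)"
    using mem_v by simp
  have v_unique: "v' = v" if v': "inductive_in M v'"
    "\<forall>u. inductive_in M u \<longrightarrow> (\<forall>x\<in>dom M. x \<epsilon> v' \<longrightarrow> x \<epsilon> u)" for v'
  proof (rule ext)
    show "v' \<in> dom M" using v'(1) by (simp add: inductive_in_iff)
    show "z \<epsilon> v' \<longleftrightarrow> z \<epsilon> v" if "z \<in> dom M" for z
      using v'(2)[rule_format, OF v_ind that] v_least[rule_format, OF v'(1) that] by blast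
  qed (rule v(1))
  show ?thesis unfolding omega_def
    by (rule theI'[OF ex1I[of _ v]], rule conjI[OF v_ind v_least], elim conjE, rule v_unique)
qed

section \<open>Induction and order on the natural numbers of M\<close>

lemmas omega_inductive = omega_least[THEN conjunct1]

lemma omega_dom: "omega M \<in> dom M"
  using omega_inductive by (simp add: inductive_in_iff)

lemma nats_dom: "x \<in> nats M \<Longrightarrow> x \<in> dom M" by (simp add: nats_def)

lemma nats_subset: "nats M \<subseteq> dom M" by (auto simp: nats_def)

lemma mem_omega_iff: "x \<in> dom M \<Longrightarrow> x \<epsilon> omega M \<longleftrightarrow> x \<in> nats M" by (simp add: nats_def)

lemma quantifier_range_nats: "quantifier_range M (nats M)"
  using omega_dom unfolding quantifier_range_def nats_def by blast

lemma vempty_nat [simp]: "vempty M \<in> nats M"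
  using omega_inductive vempty by (simp add: inductive_in_iff nats_def)

lemma vsucc_nat [simp]: "x \<in> nats M \<Longrightarrow> vsucc M x \<in> nats M"
  using omega_inductive vsucc by (simp add: inductive_in_iff nats_def)

lemma definable_nats: "definable M (dom M) P \<Longrightarrow> definable M (nats M) P"
  by (rule definable_mono[OF _ nats_subset])

text \<open>The set of numbers with property P has to be an element of M in order to be compared
  with \<open>omega M\<close>; definability provides it through separation.\<close>

lemma nats_induct [consumes 1, case_names definable zero succ]:
  assumes x: "x \<in> nats M" and d: "definable M (nats M) (\<lambda>e. P (e 0))"
    and 0: "P (vempty M)" and S: "\<And>x. x \<in> nats M \<Longrightarrow> P x \<Longrightarrow> P (vsucc M x)"
  shows "P x"
proof -
  obtain u where u: "u \<in> dom M" "\<forall>z\<in>dom M. z \<epsilon> u \<longleftrightarrow> z \<epsilon> omega M \<and> P z"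
    using separation[OF d omega_dom] by (auto simp: nats_def)
  have "inductive_in M u" using u 0 S vempty_nat vsucc_nat vsucc
    by (auto simp: inductive_in_iff nats_def)
  then show ?thesis using omega_least[THEN conjunct2, rule_format, of u x] x u(2) by (auto simp: nats_def)
qed

lemma nats_transitive: "x \<in> nats M \<Longrightarrow> y \<in> dom M \<Longrightarrow> y \<epsilon> x \<Longrightarrow> y \<in> nats M"
proof -
  assume "x \<in> nats M"
  then have "\<forall>y\<in>dom M. y \<epsilon> x \<longrightarrow> y \<epsilon> omega M"
  proof (induction rule: nats_induct)
    case definable
    show ?case by (intro definable_nats definable_rules omega_dom)
  qed (auto simp: vempty vsucc nats_def)
  then show "y \<in> dom M \<Longrightarrow> y \<epsilon> x \<Longrightarrow> y \<in> nats M" by (simp add: nats_def)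
qed

lemma less_trans: "x \<in> nats M \<Longrightarrow> y \<in> nats M \<Longrightarrow> z \<in> nats M \<Longrightarrow> z \<prec> y \<Longrightarrow> y \<prec> x \<Longrightarrow> z \<prec> x"
proof -
  assume "x \<in> nats M"
  then have "\<forall>y\<in>nats M. \<forall>z\<in>nats M. z \<prec> y \<and> y \<prec> x \<longrightarrow> z \<prec> x"
  proof (induction rule: nats_induct)
    case definable
    show ?case by (intro definable_rules quantifier_range_nats)
  next
    case (succ x)
    have "z \<epsilon> vsucc M x \<longleftrightarrow> z \<epsilon> x \<or> z = x" if "z \<in> nats M" for z
      using succ.hyps that by (simp add: vsucc nats_dom)
    with succ.IH show ?case by blast
  qed (simp add: vempty nats_dom)
  then show "y \<in> nats M \<Longrightarrow> z \<in> nats M \<Longrightarrow> z \<prec> y \<Longrightarrow> y \<prec> x \<Longrightarrow> z \<prec> x" by blast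
qed

lemma less_irrefl: "x \<in> nats M \<Longrightarrow> \<not> x \<prec> x"
proof (induction rule: nats_induct)
  case definable
  show ?case by (intro definable_rules quantifier_range_nats)
next
  case (succ x)
  then show ?case using less_trans[of x "vsucc M x" x] vsucc(2) nats_dom vsucc_nat by metis
qed (simp add: vempty)

lemma zero_le: "x \<in> nats M \<Longrightarrow> vempty M \<prec> x \<or> vempty M = x"
proof (induction rule: nats_induct)
  case definable
  show ?case by (intro definable_rules quantifier_range_nats vempty_nat)
qed (auto simp: vsucc nats_dom)

lemma vsucc_le: "y \<in> nats M \<Longrightarrow> x \<in> nats M \<Longrightarrow> x \<prec> y \<Longrightarrow> vsucc M x \<prec> y \<or> vsucc M x = y"
proof -
  assume "y \<in> nats M"
  then have "\<forall>x\<in>nats M. x \<prec> y \<longrightarrow> vsucc M x \<prec> y \<or> vsucc M x = y"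
  proof (induction rule: nats_induct)
    case definable
    \<comment> \<open>The quantifier is written over \<open>dom M\<close> and bounded by
      \<open>omega M\<close>, as \<open>vsucc\<close> is so far known to be a definable term on
      \<open>dom M\<close> only.\<close>
    have "definable M (nats M) (\<lambda>e. \<forall>x\<in>dom M. x \<epsilon> omega M \<longrightarrow> x \<epsilon> e 0 \<longrightarrow> vsucc M x \<epsilon> e 0 \<or> vsucc M x = e 0)"
      by (intro definable_nats definable_rules definable_term_vsucc omega_dom)
    then show ?case by (rule definable_cong) (auto simp: nats_def)
  qed (auto simp: vempty vsucc nats_dom)
  then show "x \<in> nats M \<Longrightarrow> x \<prec> y \<Longrightarrow> vsucc M x \<prec> y \<or> vsucc M x = y" by blast
qed

lemma less_linear:
  assumes "x \<in> nats M" and y: "y \<in> nats M"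
  shows "x \<prec> y \<or> x = y \<or> y \<prec> x"
  using assms(1)
proof (induction x rule: nats_induct)
  case definable
  show ?case by (intro definable_rules quantifier_range_nats y)
next
  case zero
  show ?case using zero_le y by blast
next
  case (succ x)
  then show ?case using vsucc_le[OF y, of x] y vsucc(2)[of x y] by (auto simp: nats_dom)
qed

lemma vsucc_inj: "x \<in> nats M \<Longrightarrow> y \<in> nats M \<Longrightarrow> vsucc M x = vsucc M y \<longleftrightarrow> x = y"
  using vsucc(2)[of x x] vsucc(2)[of y y] vsucc(2)[of y x] vsucc(2)[of x y] less_irrefl[of x]
    less_trans[of x y x] nats_dom by metis

lemma vsucc_nonzero: "x \<in> nats M \<Longrightarrow> vsucc M x \<noteq> vempty M"
  using vsucc(2)[of x x] vempty(2)[of x] by (auto simp: nats_dom)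

lemma vsucc_less_vsucc:
  "x \<in> nats M \<Longrightarrow> y \<in> nats M \<Longrightarrow> x \<prec> y \<Longrightarrow> vsucc M x \<prec> vsucc M y"
  using vsucc_le[of y x] by (auto simp: vsucc nats_dom)

lemma less_vsucc: "x \<in> nats M \<Longrightarrow> y \<in> nats M \<Longrightarrow> x \<prec> vsucc M y \<longleftrightarrow> x \<prec> y \<or> x = y"
  using vsucc by (simp add: nats_dom)

end

subsection \<open>Recursion\<close>

text \<open>The witness inside \<open>iterates\<close>, without its end point, so that histories can
  be compared and extended.\<close>

definition history ::
  "('a, 'b) struct_scheme \<Rightarrow> ('a \<Rightarrow> 'a \<Rightarrow> bool) \<Rightarrow> 'a \<Rightarrow> 'a \<Rightarrow> 'a \<Rightarrow> bool" where
  "history M G a z h \<longleftrightarrow> is_fun M h (vsucc M z) \<and> app M h (vempty M) = a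
     \<and> (\<forall>i\<in>dom M. i \<epsilon>\<^bsub>M\<^esub> z \<longrightarrow> G (app M h i) (app M h (vsucc M i)))"

lemma historyD:
  assumes "history M G a z h"
  shows "is_fun M h (vsucc M z)" "app M h (vempty M) = a"
    "i \<in> dom M \<Longrightarrow> i \<epsilon>\<^bsub>M\<^esub> z \<Longrightarrow> G (app M h i) (app M h (vsucc M i))"
  using assms by (auto simp: history_def)

lemma iterates_iff_history: "iterates M G a z r \<longleftrightarrow> (\<exists>h. history M G a z h \<and> app M h z = r)"
  by (auto simp: iterates_def history_def)

context zf
begin

lemma is_fun_app:
  assumes "is_fun M h d" "x \<in> dom M" "x \<epsilon> d"
  shows "app M h x \<in> dom M" "opair M x (app M h x) \<epsilon> h"
proof -
  have "\<exists>!y. y \<in> dom M \<and> opair M x y \<epsilon> h" using assms unfolding is_fun_def by blast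
  from theI'[OF this] show "app M h x \<in> dom M" "opair M x (app M h x) \<epsilon> h" by (auto simp: app_def)
qed

lemma is_fun_app_eq:
  assumes "is_fun M h d" "x \<in> dom M" "x \<epsilon> d" "y \<in> dom M"
  shows "opair M x y \<epsilon> h \<longleftrightarrow> app M h x = y"
proof -
  have "\<exists>!y. y \<in> dom M \<and> opair M x y \<epsilon> h" using assms unfolding is_fun_def by blast
  then show ?thesis using is_fun_app[OF assms(1-3)] assms(4) by blast
qed

lemma definable_is_fun:
  assumes "definable_term M (dom M) s" "definable_term M (dom M) t"
  shows "definable M (dom M) (\<lambda>e. is_fun M (s e) (t e))"
proof (rule definable_subst2[OF quantifier_range_dom _ assms])
  have "definable M (dom M) (\<lambda>e.
      (\<forall>p\<in>dom M. p \<epsilon> e 0 \<longrightarrow> (\<exists>x\<in>dom M. \<exists>y\<in>dom M. x \<epsilon> e 1 \<and> p = opair M x y))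
     \<and> (\<forall>x\<in>dom M. x \<epsilon> e 1 \<longrightarrow>
         (\<exists>y\<in>dom M. opair M x y \<epsilon> e 0 \<and> (\<forall>w\<in>dom M. opair M x w \<epsilon> e 0 \<longrightarrow> w = y))))"
    by (intro definable_rules definable_term_opair)
  then show "definable M (dom M) (\<lambda>e. is_fun M (e 0) (e 1))"
  proof (rule definable_cong)
    fix e :: "nat \<Rightarrow> 'a" assume "range e \<subseteq> dom M"
    then have "e 0 \<in> dom M" by auto
    moreover have "(\<exists>!y. y \<in> dom M \<and> R y) \<longleftrightarrow> (\<exists>y\<in>dom M. R y \<and> (\<forall>w\<in>dom M. R w \<longrightarrow> w = y))" for R
      by blast
    ultimately show "((\<forall>p\<in>dom M. p \<epsilon> e 0 \<longrightarrow> (\<exists>x\<in>dom M. \<exists>y\<in>dom M. x \<epsilon> e 1 \<and> p = opair M x y))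
     \<and> (\<forall>x\<in>dom M. x \<epsilon> e 1 \<longrightarrow>
         (\<exists>y\<in>dom M. opair M x y \<epsilon> e 0 \<and> (\<forall>w\<in>dom M. opair M x w \<epsilon> e 0 \<longrightarrow> w = y)))) =
         is_fun M (e 0) (e 1)" unfolding is_fun_def by simp
  qed
qed

lemma definable_opair_mem:
  assumes "h \<in> dom M" "definable_term M (nats M) s" "definable_term M (nats M) t"
  shows "definable M (nats M) (\<lambda>e. opair M (s e) (t e) \<epsilon> h)"
  by (rule definable_subst2[OF quantifier_range_nats definable_nats assms(2,3)])
    (intro definable_rules definable_term_opair assms)

lemma definable_less_const: "c \<in> nats M \<Longrightarrow> definable M (nats M) (\<lambda>e. e i \<prec> c)"
  by (intro definable_rules quantifier_range_nats)

lemma less_of_vsucc_less: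
  "i \<in> nats M \<Longrightarrow> z \<in> nats M \<Longrightarrow> vsucc M i \<prec> vsucc M z \<Longrightarrow> i \<prec> z"
  using less_trans[of z "vsucc M i" i] by (auto simp: less_vsucc)

lemma zero_less_vsucc: "z \<in> nats M \<Longrightarrow> vempty M \<prec> vsucc M z"
  using zero_le[of z] by (auto simp: less_vsucc)

text \<open>A priori the values of h are arbitrary sets of M. The step relation keeps them among the
  numbers and preserves the invariant Q.\<close>

lemma history_range:
  assumes h: "history M G a z h" and z: "z \<in> nats M" and a: "a \<in> nats M" "Q a"
    and Q: "definable M (nats M) (\<lambda>e. Q (e 0))"
    and G: "\<And>x y. x \<in> nats M \<Longrightarrow> Q x \<Longrightarrow> G x y \<Longrightarrow> y \<in> nats M \<and> Q y"
    and i: "i \<in> nats M" "i \<prec> vsucc M z"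
  shows "app M h i \<in> nats M \<and> Q (app M h i)"
proof -
  have fn: "is_fun M h (vsucc M z)" and hM: "h \<in> dom M"
    using h by (auto simp: history_def is_fun_def)
  \<comment> \<open>The form fit for induction: \<open>app\<close> is a description, whereas
    membership of a pair in the fixed set h is definable.\<close>
  have *: "(\<exists>y\<in>nats M. Q y \<and> opair M i y \<epsilon> h) \<longleftrightarrow> app M h i \<in> nats M \<and> Q (app M h i)"
    if "i \<in> nats M" "i \<prec> vsucc M z" for i
    using is_fun_app_eq[OF fn _ that(2)] that(1) nats_dom by blast
  from i(1) have "i \<prec> vsucc M z \<longrightarrow> (\<exists>y\<in>nats M. Q y \<and> opair M i y \<epsilon> h)"
  proof (induction rule: nats_induct)
    case definable
    show ?case
      by (intro definable_imp definable_bex definable_conj definable_less_const definable_opair_mem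
          definable_term_var Q quantifier_range_nats hM z vsucc_nat)
  next
    case zero
    show ?case using *[of "vempty M"] a historyD(2)[OF h] by simp
  next
    case (succ i)
    show ?case
    proof
      assume S: "vsucc M i \<prec> vsucc M z"
      then have iz: "i \<prec> z" using succ(1) z by (rule less_of_vsucc_less[of i z, rotated 2])
      then have "i \<prec> vsucc M z" using succ z by (simp add: less_vsucc)
      with succ have "app M h i \<in> nats M \<and> Q (app M h i)" using *[of i] by blast
      moreover have "G (app M h i) (app M h (vsucc M i))"
        using succ(1) iz by (intro historyD(3)[OF h] nats_dom)
      ultimately show "\<exists>y\<in>nats M. Q y \<and> opair M (vsucc M i) y \<epsilon> h"
        using *[of "vsucc M i"] G[of "app M h i"] S vsucc_nat[OF succ(1)] by blast
    qed
  qed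
  then show ?thesis using * i by blast
qed

text \<open>Agreement at i is expressed as a common value in \<open>nats M\<close>, which is
  definable. Determinism is available only where Q holds, and \<open>history_range\<close> supplies
  that.\<close>

lemma history_unique:
  assumes h: "history M G a z h" and h': "history M G a z h'"
    and z: "z \<in> nats M" and a: "a \<in> nats M" "Q a"
    and Q: "definable M (nats M) (\<lambda>e. Q (e 0))"
    and G: "\<And>x y. x \<in> nats M \<Longrightarrow> Q x \<Longrightarrow> G x y \<Longrightarrow> y \<in> nats M \<and> Q y"
    and det: "\<And>x y y'. x \<in> nats M \<Longrightarrow> Q x \<Longrightarrow> G x y \<Longrightarrow> G x y' \<Longrightarrow> y = y'"
    and i: "i \<in> nats M" "i \<prec> vsucc M z"
  shows "app M h i = app M h' i"
proof -
  have fn: "is_fun M h (vsucc M z)" "is_fun M h' (vsucc M z)" and hM: "h \<in> dom M" "h' \<in> dom M"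
    using h h' by (auto simp: history_def is_fun_def)
  have *: "(\<exists>y\<in>nats M. opair M i y \<epsilon> h \<and> opair M i y \<epsilon> h') \<longleftrightarrow> app M h i = app M h' i"
    if "i \<in> nats M" "i \<prec> vsucc M z" for i
  proof -
    have "(\<exists>y\<in>nats M. opair M i y \<epsilon> h \<and> opair M i y \<epsilon> h') \<longleftrightarrow>
        (\<exists>y\<in>nats M. app M h i = y \<and> app M h' i = y)"
      using that by (intro bex_cong refl) (simp add: is_fun_app_eq[OF fn(1)] is_fun_app_eq[OF fn(2)] nats_dom)
    moreover have "app M h i \<in> nats M"
      by (rule conjunct1[OF history_range[where Q = Q, OF h z a Q _ that]]) (rule G)
    ultimately show ?thesis by auto
  qed
  from i(1) have "i \<prec> vsucc M z \<longrightarrow> (\<exists>y\<in>nats M. opair M i y \<epsilon> h \<and> opair M i y \<epsilon> h')"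
  proof (induction rule: nats_induct)
    case definable
    show ?case
      by (intro definable_imp definable_bex definable_conj definable_less_const definable_opair_mem
          definable_term_var quantifier_range_nats hM z vsucc_nat)
  next
    case zero
    show ?case using *[of "vempty M"] historyD(2)[OF h] historyD(2)[OF h'] by simp
  next
    case (succ i)
    show ?case
    proof
      assume S: "vsucc M i \<prec> vsucc M z"
      then have iz: "i \<prec> z" using succ(1) z by (rule less_of_vsucc_less[of i z, rotated 2])
      then have iSz: "i \<prec> vsucc M z" using succ z by (simp add: less_vsucc)
      with succ have "app M h i = app M h' i" using *[of i] by blast
      moreover have "G (app M h i) (app M h (vsucc M i))" "G (app M h' i) (app M h' (vsucc M i))"
        using historyD(3)[OF h, of i] historyD(3)[OF h', of i] nats_dom[OF succ(1)] iz by blast+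
      moreover have "app M h i \<in> nats M \<and> Q (app M h i)"
        by (rule history_range[where Q = Q, OF h z a Q _ succ(1) iSz]) (rule G)
      ultimately have "app M h (vsucc M i) = app M h' (vsucc M i)" using det[of "app M h i"] by simp
      then show "\<exists>y\<in>nats M. opair M (vsucc M i) y \<epsilon> h \<and> opair M (vsucc M i) y \<epsilon> h'"
        using *[of "vsucc M i"] S vsucc_nat[OF succ(1)] by blast
    qed
  qed
  then show ?thesis using * i by blast
qed

lemma history_zero:
  assumes a: "a \<in> dom M" shows "\<exists>h. history M G a (vempty M) h"
proof -
  define h where "h = upair M (opair M (vempty M) a) (opair M (vempty M) a)"
  have hM: "h \<in> dom M" and hmem: "\<And>z. z \<in> dom M \<Longrightarrow> z \<epsilon> h \<longleftrightarrow> z = opair M (vempty M) a"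
    unfolding h_def using a vempty(1) by (simp_all add: upair opair_dom)
  have fn: "is_fun M h (vsucc M (vempty M))"
    unfolding is_fun_def
  proof (intro conjI ballI impI)
    fix p assume "p \<in> dom M" "p \<epsilon> h"
    then show "\<exists>x\<in>dom M. \<exists>y\<in>dom M. x \<epsilon> vsucc M (vempty M) \<and> p = opair M x y"
      using hmem a vempty(1) by (intro bexI[of _ "vempty M"] bexI[of _ a]) (simp_all add: vsucc)
  next
    fix x assume x: "x \<in> dom M" "x \<epsilon> vsucc M (vempty M)"
    then have "x = vempty M" using vempty by (simp add: vsucc)
    then show "\<exists>!y. y \<in> dom M \<and> opair M x y \<epsilon> h"
      using a vempty(1) by (intro ex1I[of _ a]) (auto simp: hmem opair_dom opair_inj)
  qed (rule hM)
  moreover have "app M h (vempty M) = a"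
    using is_fun_app_eq[OF fn, of "vempty M" a] a vempty(1) hmem by (simp add: vsucc opair_dom)
  ultimately show ?thesis using vempty(2) by (auto simp: history_def)
qed

lemma history_extend:
  assumes h: "history M G a z h" and z: "z \<in> nats M" and y: "y \<in> dom M" and G: "G (app M h z) y"
  shows "\<exists>h'. history M G a (vsucc M z) h' \<and> app M h' (vsucc M z) = y"
proof -
  have fn: "is_fun M h (vsucc M z)" and hM: "h \<in> dom M"
    using h by (auto simp: history_def is_fun_def)
  have zM: "z \<in> dom M" "vsucc M z \<in> dom M" using z by (simp_all add: nats_dom)
  define p where "p = opair M (vsucc M z) y"
  have pM: "p \<in> dom M" unfolding p_def using zM y by (simp add: opair_dom)
  obtain h' where h'M: "h' \<in> dom M" and mem: "\<And>q. q \<in> dom M \<Longrightarrow> q \<epsilon> h' \<longleftrightarrow> q \<epsilon> h \<or> q = p"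
    using ex_adjoin[OF hM pM] by blast
  \<comment> \<open>First components of pairs in h lie in z + 1, and z + 1 is not a member of
    itself. So the adjoined pair does not compete with an old one and h' remains a function.\<close>
  have dom_h: "x \<epsilon> vsucc M z" if xw: "x \<in> dom M" "w \<in> dom M" "opair M x w \<epsilon> h" for x w
  proof -
    have "opair M x w \<in> dom M" using xw by (simp add: opair_dom)
    then obtain x' w' where "x' \<in> dom M" "w' \<in> dom M" "x' \<epsilon> vsucc M z" "opair M x w = opair M x' w'"
      using fn xw(3) unfolding is_fun_def by blast
    then show ?thesis using xw opair_inj[of x w x' w'] by simp
  qed
  have new: "opair M (vsucc M z) w \<epsilon> h' \<longleftrightarrow> w = y" if "w \<in> dom M" for w
    using that zM y dom_h[of "vsucc M z" w] less_irrefl[of "vsucc M z"] z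
    by (auto simp: mem opair_dom p_def opair_inj)
  have old: "opair M x w \<epsilon> h' \<longleftrightarrow> opair M x w \<epsilon> h" if "w \<in> dom M" "x \<in> dom M" "x \<epsilon> vsucc M z" for x w
    using that zM y less_irrefl[of "vsucc M z"] z
    by (auto simp: mem opair_dom p_def opair_inj)
  have fn': "is_fun M h' (vsucc M (vsucc M z))"
    unfolding is_fun_def
  proof (intro conjI ballI impI)
    fix q assume q: "q \<in> dom M" "q \<epsilon> h'"
    show "\<exists>x\<in>dom M. \<exists>y\<in>dom M. x \<epsilon> vsucc M (vsucc M z) \<and> q = opair M x y"
    proof (cases "q = p")
      case True
      then show ?thesis using zM y by (auto simp: p_def vsucc)
    next
      case False
      then have "q \<epsilon> h" using mem q by blast
      then obtain x w where "x \<in> dom M" "w \<in> dom M" "x \<epsilon> vsucc M z" "q = opair M x w"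
        using fn q(1) unfolding is_fun_def by blast
      then show ?thesis using zM by (auto simp: vsucc(2)[of "vsucc M z"])
    qed
  next
    fix x assume x: "x \<in> dom M" "x \<epsilon> vsucc M (vsucc M z)"
    then consider "x \<epsilon> vsucc M z" | "x = vsucc M z" using vsucc(2)[of "vsucc M z"] zM by blast
    then show "\<exists>!w. w \<in> dom M \<and> opair M x w \<epsilon> h'"
    proof cases
      case 1
      then have "\<exists>!w. w \<in> dom M \<and> opair M x w \<epsilon> h" using fn x(1) unfolding is_fun_def by blast
      then show ?thesis using old[OF _ x(1) 1] by (simp cong: conj_cong)
    next
      case 2
      then show ?thesis using new y by (intro ex1I[of _ y]) auto
    qed
  qed (rule h'M)
  have app_old: "app M h' x = app M h x" if "x \<in> dom M" "x \<epsilon> vsucc M z" for x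
  proof -
    have "x \<epsilon> vsucc M (vsucc M z)" using that zM by (simp add: vsucc(2)[of "vsucc M z"])
    then show ?thesis
      using is_fun_app_eq[OF fn' that(1)] is_fun_app[OF fn that] old[OF _ that] by blast
  qed
  have app_new: "app M h' (vsucc M z) = y"
    using is_fun_app_eq[OF fn' zM(2) _ y] new[OF y] zM by (simp add: vsucc(2)[of "vsucc M z"])
  have "G (app M h' i) (app M h' (vsucc M i))" if i: "i \<in> dom M" "i \<epsilon> vsucc M z" for i
  proof (cases "i = z")
    case True
    then show ?thesis using G app_old[of z] app_new zM by (simp add: vsucc(2)[of z])
  next
    case False
    then have iz: "i \<epsilon> z" using i zM vsucc by blast
    have iN: "i \<in> nats M" using nats_transitive z i(1) iz by blast
    have "vsucc M i \<epsilon> vsucc M z" using iN z iz by (rule vsucc_less_vsucc)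
    then show ?thesis using app_old[OF i] app_old[of "vsucc M i"] historyD(3)[OF h i(1) iz] i \<open>vsucc M i \<epsilon> vsucc M z\<close>
      by (simp add: vsucc(1))
  qed
  then have "history M G a (vsucc M z) h'"
    using fn' app_old[of "vempty M"] zero_less_vsucc[OF z] historyD(2)[OF h] vempty(1) by (simp add: history_def)
  with app_new show ?thesis by blast
qed

text \<open>Histories are sets, so formulas about them range over \<open>dom M\<close>, while step
  relations are definable on \<open>nats M\<close> only. Such a formula may be wrong as soon as any
  environment value is not a number; hence \<open>min i 2\<close> redirects all variables to the
  first three, and these are guarded by membership in omega.\<close>

lemma definable_dom_of_nats:
  assumes P: "definable M (nats M) (\<lambda>e. G (e 0) (e 1) (e 2))"
  shows "definable M (dom M) (\<lambda>e. e 0 \<in> nats M \<and> e 1 \<in> nats M \<and> e 2 \<in> nats M \<and> G (e 0) (e 1) (e 2))"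
proof -
  let ?\<rho> = "\<lambda>i. min i (2::nat)"
  obtain p c where p: "range c \<subseteq> dom M"
      "\<And>e. range e \<subseteq> nats M \<Longrightarrow> G (e 0) (e 1) (e 2) = sat M (mix e c) p"
    using P unfolding definable_def by blast
  obtain p' where p': "\<And>e. sat M e p' = sat M (\<lambda>i. e (mix (\<lambda>i. 2 * ?\<rho> i) (\<lambda>i. Suc (2 * i)) i)) p"
    using sat_rename by metis
  have ren: "(\<lambda>i. mix e c (mix (\<lambda>i. 2 * ?\<rho> i) (\<lambda>i. Suc (2 * i)) i)) = mix (\<lambda>i. e (?\<rho> i)) c" for e
    by (rule mix_eqI) (simp_all only: mix_simps)
  have G: "G (e 0) (e 1) (e 2) = sat M (mix e c) p'"
    if "e 0 \<in> nats M" "e 1 \<in> nats M" "e 2 \<in> nats M" for e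
  proof -
    have "e (?\<rho> i) \<in> nats M" for i
      using that by (cases i rule: nat.exhaust; cases "i - 1") (auto simp: min_def numeral_2_eq_2)
    then show ?thesis unfolding p' ren using p(2)[of "\<lambda>i. e (?\<rho> i)"] by auto
  qed
  have "definable M (dom M) (\<lambda>e. sat M (mix e c) p')"
    unfolding definable_def using p(1) by blast
  then have "definable M (dom M) (\<lambda>e. e 0 \<epsilon> omega M \<and> e 1 \<epsilon> omega M \<and> e 2 \<epsilon> omega M \<and> sat M (mix e c) p')"
    by (intro definable_rules omega_dom)
  then show ?thesis
  proof (rule definable_cong)
    fix e :: "nat \<Rightarrow> 'a" assume "range e \<subseteq> dom M"
    then have "e i \<in> dom M" for i by auto
    then show "(e 0 \<epsilon> omega M \<and> e 1 \<epsilon> omega M \<and> e 2 \<epsilon> omega M \<and> sat M (mix e c) p') =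
      (e 0 \<in> nats M \<and> e 1 \<in> nats M \<and> e 2 \<in> nats M \<and> G (e 0) (e 1) (e 2))"
      using G[of e] by (auto simp: mem_omega_iff)
  qed
qed

text \<open>K expresses \<open>app\<close> by pairs in the history and replaces the step by its
  guarded form H, definable on all of \<open>dom M\<close>. The guard loses nothing, since
  \<open>G_nats\<close> keeps histories among the numbers. The parameter p becomes the left operand
  of the arithmetic operations.\<close>

lemma definable_iterates:
  assumes G: "definable M (nats M) (\<lambda>e. G (e 0) (e 1) (e 2))"
    and G_nats: "\<And>p x y. p \<in> nats M \<Longrightarrow> x \<in> nats M \<Longrightarrow> G p x y \<Longrightarrow> y \<in> nats M"
  shows "definable M (nats M) (\<lambda>e. iterates M (G (e 0)) (e 1) (e 2) (e 3))"
proof -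
  define H where "H p x y \<longleftrightarrow> p \<in> nats M \<and> x \<in> nats M \<and> y \<in> nats M \<and> G p x y" for p x y
  define K where "K p a z r \<longleftrightarrow> (\<exists>h\<in>dom M. is_fun M h (vsucc M z) \<and> opair M (vempty M) a \<epsilon> h \<and>
     (\<forall>i\<in>dom M. i \<epsilon> z \<longrightarrow> (\<exists>x\<in>dom M. \<exists>y\<in>dom M.
        opair M i x \<epsilon> h \<and> opair M (vsucc M i) y \<epsilon> h \<and> H p x y)) \<and> opair M z r \<epsilon> h)" for p a z r
  have H: "definable M (dom M) (\<lambda>e. H (e i) (e j) (e k))" for i j k
    by (rule definable_subst3[OF quantifier_range_dom definable_dom_of_nats[OF G, folded H_def]])
      (rule definable_term_var)+
  have "definable M (nats M) (\<lambda>e. K (e 0) (e 1) (e 2) (e 3))"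
    unfolding K_def
    by (intro definable_nats definable_rules definable_is_fun definable_term_opair
        definable_term_vsucc H vempty(1))
  then show ?thesis
  proof (rule definable_cong)
    fix e :: "nat \<Rightarrow> 'a" assume "range e \<subseteq> nats M"
    then have "e i \<in> nats M" for i by auto
    then obtain p a z r where eqs: "e 0 = p" "e 1 = a" "e 2 = z" "e 3 = r"
      and N: "p \<in> nats M" "a \<in> nats M" "z \<in> nats M" "r \<in> nats M" by blast
    have zS: "vempty M \<epsilon> vsucc M z" "z \<epsilon> vsucc M z"
      using N zero_less_vsucc by (simp_all add: less_vsucc)
    have iS: "i \<epsilon> vsucc M z \<and> vsucc M i \<epsilon> vsucc M z \<and> vsucc M i \<in> dom M \<and> i \<in> nats M"
      if "i \<in> dom M" "i \<epsilon> z" for i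
    proof -
      have "i \<in> nats M" using nats_transitive N(3) that by blast
      then show ?thesis using that N(3) vsucc_less_vsucc by (simp add: less_vsucc nats_dom)
    qed
    have "K p a z r \<longleftrightarrow> iterates M (G p) a z r"
    proof
      assume "K p a z r"
      then obtain h where h: "is_fun M h (vsucc M z)" "opair M (vempty M) a \<epsilon> h" "opair M z r \<epsilon> h"
        and step: "\<And>i. i \<in> dom M \<Longrightarrow> i \<epsilon> z \<Longrightarrow> \<exists>x\<in>dom M. \<exists>y\<in>dom M.
          opair M i x \<epsilon> h \<and> opair M (vsucc M i) y \<epsilon> h \<and> H p x y"
        unfolding K_def by blast
      have "G p (app M h i) (app M h (vsucc M i))" if i: "i \<in> dom M" "i \<epsilon> z" for i
      proof -
        obtain x y where xy: "x \<in> dom M" "y \<in> dom M"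
          "opair M i x \<epsilon> h" "opair M (vsucc M i) y \<epsilon> h" "H p x y" using step[OF i] by blast
        then have "app M h i = x" "app M h (vsucc M i) = y"
          using is_fun_app_eq[OF h(1)] iS[OF i] i by blast+
        then show ?thesis using xy(5) by (simp add: H_def)
      qed
      moreover have "app M h (vempty M) = a" "app M h z = r"
        using is_fun_app_eq[OF h(1)] zS h(2,3) N vempty(1) nats_dom by blast+
      ultimately show "iterates M (G p) a z r" using h(1) unfolding iterates_def by blast
    next
      assume "iterates M (G p) a z r"
      then obtain h where h: "history M (G p) a z h" "app M h z = r"
        unfolding iterates_iff_history by blast
      then have fn: "is_fun M h (vsucc M z)" and hM: "h \<in> dom M"
        by (auto simp: history_def is_fun_def)
      have rng: "app M h i \<in> nats M" if "i \<in> nats M" "i \<epsilon> vsucc M z" for i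
      proof -
        \<comment> \<open>The trivial invariant, written as an equation so that it is visibly
          definable; only the range of h is of interest.\<close>
        have "app M h i \<in> nats M \<and> vempty M = vempty M"
        proof (rule history_range[where Q = "\<lambda>_. vempty M = vempty M", OF h(1) N(3,2) refl _ _ that])
          show "definable M (nats M) (\<lambda>e. vempty M = vempty M)"
            by (intro definable_rules quantifier_range_nats vempty_nat)
          fix x y assume "x \<in> nats M" "G p x y"
          then show "y \<in> nats M \<and> vempty M = vempty M" using G_nats[OF N(1)] by simp
        qed
        then show ?thesis by blast
      qed
      show "K p a z r" unfolding K_def
      proof (rule bexI[OF _ hM], intro conjI ballI impI)
        show "opair M (vempty M) a \<epsilon> h" "opair M z r \<epsilon> h"
          using is_fun_app(2)[OF fn] zS historyD(2)[OF h(1)] h(2) vempty(1) N(3) nats_dom by metis+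
        fix i assume i: "i \<in> dom M" "i \<epsilon> z"
        show "\<exists>x\<in>dom M. \<exists>y\<in>dom M. opair M i x \<epsilon> h \<and> opair M (vsucc M i) y \<epsilon> h \<and> H p x y"
          using is_fun_app[OF fn i(1)] is_fun_app[OF fn, of "vsucc M i"] iS[OF i] rng[of i] rng[of "vsucc M i"]
            N(1) historyD(3)[OF h(1) i] unfolding H_def
          by (intro bexI[of _ "app M h i"] bexI[of _ "app M h (vsucc M i)"]) auto
      qed (rule fn)
    qed
    then show "K (e 0) (e 1) (e 2) (e 3) = iterates M (G (e 0)) (e 1) (e 2) (e 3)"
      unfolding eqs .
  qed
qed

end

text \<open>Totality and determinism are demanded only under the invariant Q, since a machine step
  is total on codes of states alone. For arithmetic Q is trivially true. By contrast
  \<open>step_nats\<close> is free of Q: the formula for \<open>iterates\<close> has to be right for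
  every start value, as \<open>definable_iterates\<close> requires.\<close>

locale iteration = zf +
  fixes G :: "'a \<Rightarrow> 'a \<Rightarrow> bool" and Q :: "'a \<Rightarrow> bool" and a :: 'a
  assumes start: "a \<in> nats M" "Q a"
    and definable_Q: "definable M (nats M) (\<lambda>e. Q (e 0))"
    and definable_step: "definable M (nats M) (\<lambda>e. G (e 0) (e 1))"
    and step_nats: "\<And>x y. x \<in> nats M \<Longrightarrow> G x y \<Longrightarrow> y \<in> nats M"
    and step_preserves: "\<And>x y. x \<in> nats M \<Longrightarrow> Q x \<Longrightarrow> G x y \<Longrightarrow> Q y"
    and step_total: "\<And>x. x \<in> nats M \<Longrightarrow> Q x \<Longrightarrow> \<exists>y. G x y"
    and step_unique: "\<And>x y y'. x \<in> nats M \<Longrightarrow> Q x \<Longrightarrow> G x y \<Longrightarrow> G x y' \<Longrightarrow> y = y'"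
begin

lemma history_closed:
  assumes "history M G a z h" "z \<in> nats M" "i \<in> nats M" "i \<prec> vsucc M z"
  shows "app M h i \<in> nats M \<and> Q (app M h i)"
  by (rule history_range[where Q = Q, OF assms(1,2) start definable_Q _ assms(3,4)])
    (auto intro: step_nats step_preserves)

lemma iterates_closed:
  assumes "iterates M G a z r" "z \<in> nats M" shows "r \<in> nats M \<and> Q r"
proof -
  obtain h where "history M G a z h" "app M h z = r"
    using assms(1) unfolding iterates_iff_history by blast
  then show ?thesis using history_closed[of z h z] assms(2) by (auto simp: less_vsucc)
qed

lemma iterates_unique:
  assumes "iterates M G a z r" "iterates M G a z r'" "z \<in> nats M" shows "r = r'"
proof -
  obtain h h' where h: "history M G a z h" "app M h z = r" "history M G a z h'" "app M h' z = r'"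
    using assms(1,2) unfolding iterates_iff_history by blast
  have "app M h z = app M h' z"
    by (rule history_unique[where Q = Q, OF h(1) h(3) assms(3) start definable_Q])
      (use assms(3) in \<open>auto intro: step_nats step_preserves simp: less_vsucc dest: step_unique\<close>)
  then show ?thesis using h by simp
qed

lemma iterates_zero: "iterates M G a (vempty M) a"
  using history_zero[of a G] start nats_dom unfolding iterates_iff_history by (auto simp: history_def)

lemma iterates_vsucc:
  assumes "iterates M G a z r" "z \<in> nats M" "G r s" shows "iterates M G a (vsucc M z) s"
proof -
  obtain h where h: "history M G a z h" "app M h z = r"
    using assms(1) unfolding iterates_iff_history by blast
  have "s \<in> dom M" using iterates_closed[OF assms(1,2)] step_nats[OF _ assms(3)] nats_dom by blast
  then show ?thesis
    using history_extend[OF h(1) assms(2), of s] h(2) assms(3) unfolding iterates_iff_history by blast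
qed

lemma definable_iterates_fixed: "definable M (nats M) (\<lambda>e. iterates M G a (e 0) (e 1))"
proof -
  have "definable M (nats M) (\<lambda>e. iterates M G (e 1) (e 2) (e 3))"
    by (rule definable_iterates[of "\<lambda>_. G"])
      (use definable_rename[OF definable_step, of Suc] step_nats in \<open>auto simp: numeral_2_eq_2\<close>)
  then have "definable M (nats M) (\<lambda>e. iterates M G (e 0) (e 1) (e 2))"
    using definable_rename[of M _ "\<lambda>e. iterates M G (e 1) (e 2) (e 3)" "\<lambda>i. i - 1"] by simp
  from definable_subst3[OF quantifier_range_nats this definable_term_const definable_term_var
      definable_term_var, OF start(1) quantifier_range_nats]
  show ?thesis .
qed

text \<open>The history is extended step by step inside M. This is an induction over a possibly
  nonstandard z, legitimate because \<open>iterates\<close> is definable.\<close>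

lemma ex_iterates: "z \<in> nats M \<Longrightarrow> \<exists>r\<in>nats M. iterates M G a z r"
proof (induction rule: nats_induct)
  case definable
  show ?case
    using definable_rename[OF definable_iterates_fixed, of "\<lambda>i. 1 - i"]
    by (intro definable_bex quantifier_range_nats) simp
next
  case zero
  show ?case using iterates_zero start by blast
next
  case (succ z)
  then show ?case using iterates_closed iterates_vsucc step_total step_nats by meson
qed

definition "result z = (THE r. iterates M G a z r)"

lemma result_eq: "z \<in> nats M \<Longrightarrow> iterates M G a z r \<Longrightarrow> result z = r"
  unfolding result_def using iterates_unique by blast

lemma iterates_result: "z \<in> nats M \<Longrightarrow> iterates M G a z (result z)"
  using ex_iterates result_eq by metis

lemma result_closed: "z \<in> nats M \<Longrightarrow> result z \<in> nats M" "z \<in> nats M \<Longrightarrow> Q (result z)"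
  using iterates_closed iterates_result by blast+

lemma result_zero: "result (vempty M) = a"
  using result_eq iterates_zero by simp

lemma result_vsucc: "z \<in> nats M \<Longrightarrow> G (result z) (result (vsucc M z))"
  using iterates_vsucc iterates_result result_eq step_total result_closed vsucc_nat by metis

lemma iterates_iff: "z \<in> nats M \<Longrightarrow> iterates M G a z r \<longleftrightarrow> r = result z"
  using iterates_result result_eq by metis

lemma definable_term_result:
  assumes "definable_term M (nats M) t" shows "definable_term M (nats M) (\<lambda>e. result (t e))"
proof (rule definable_term_app1[OF quantifier_range_nats result_closed(1) _ assms])
  have "definable M (nats M) (\<lambda>e. iterates M G a (e 1) (e 0))"
    using definable_rename[OF definable_iterates_fixed, of "\<lambda>i. 1 - i"] by simp
  then show "definable M (nats M) (\<lambda>e. e 0 = result (e 1))"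
    by (rule definable_cong) (simp add: iterates_iff image_subset_iff)
qed

end

subsection \<open>Arithmetic\<close>

context zf
begin

lemma definable_True: "definable M D (\<lambda>e. True)"
  by (rule definable_cong[OF definable_var_eq[of D 0 0]]) simp

text \<open>Common to sum, product and power: the step has the left operand as parameter, and its
  definability comes from the preceding operation. The start value A is the left operand for sums
  and a constant for products and powers.\<close>

lemma definable_term_graph2:
  assumes F: "\<And>x y. x \<in> nats M \<Longrightarrow> y \<in> nats M \<Longrightarrow> F x y \<in> nats M"
    and G: "definable M (nats M) (\<lambda>e. G (e 0) (e 1) (e 2))"
    and G_nats: "\<And>p x y. p \<in> nats M \<Longrightarrow> x \<in> nats M \<Longrightarrow> G p x y \<Longrightarrow> y \<in> nats M"
    and A: "definable_term M (nats M) (\<lambda>e. A (e 1))"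
    and FG: "\<And>x y r. x \<in> nats M \<Longrightarrow> y \<in> nats M \<Longrightarrow> iterates M (G x) (A x) y r \<longleftrightarrow> r = F x y"
    and st: "definable_term M (nats M) s" "definable_term M (nats M) t"
  shows "definable_term M (nats M) (\<lambda>e. F (s e) (t e))"
proof (rule definable_term_app2[OF quantifier_range_nats F _ st])
  \<comment> \<open>The start value is moved to variable 0, where \<open>definable_subst\<close> can
    replace it by the term A.\<close>
  have "definable M (nats M) (\<lambda>e. iterates M (G (e 2)) (e 0) (e 3) (e 1))"
    using definable_rename[where P = "\<lambda>e. iterates M (G (e 0)) (e 1) (e 2) (e 3)"
        and \<rho> = "case_nat 2 (case_nat 0 (case_nat 3 (\<lambda>_. 1)))", OF definable_iterates[OF G G_nats]] by (simp add: numeral_2_eq_2 numeral_3_eq_3)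
  then have "definable M (nats M) (\<lambda>e. iterates M (G (e 1)) (A (e 1)) (e 2) (e 0))"
    using definable_subst[where P = "\<lambda>x e. iterates M (G (e 1)) x (e 2) (e 0)",
        OF quantifier_range_nats _ A] by (simp add: numeral_2_eq_2 numeral_3_eq_3)
  then show "definable M (nats M) (\<lambda>e. e 0 = F (e 1) (e 2))"
    by (rule definable_cong) (simp add: FG image_subset_iff)
qed

lemma definable_term_vsucc_nats:
  assumes "definable_term M (nats M) t" shows "definable_term M (nats M) (\<lambda>e. vsucc M (t e))"
proof (rule definable_term_app1[OF quantifier_range_nats vsucc_nat _ assms])
  show "definable M (nats M) (\<lambda>e. e 0 = vsucc M (e 1))"
    by (intro definable_nats definable_rules definable_term_vsucc)
qed

lemmas nats_definable_rules = definable_rules quantifier_range_nats definable_term_vsucc_nats definable_True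

section \<open>Sum, product and power as iterations\<close>

lemma iteration_add: "a \<in> nats M \<Longrightarrow> iteration M (\<lambda>x y. y = vsucc M x) (\<lambda>_. True) a"
  by unfold_locales (auto intro!: nats_definable_rules)

lemma nadd_result: "a \<in> nats M \<Longrightarrow> a \<oplus> b = iteration.result M (\<lambda>x y. y = vsucc M x) a b"
  by (simp add: nadd_def iteration.result_def[OF iteration_add])

lemma add_closed [simp]: "a \<in> nats M \<Longrightarrow> b \<in> nats M \<Longrightarrow> a \<oplus> b \<in> nats M"
  by (simp add: nadd_result iteration.result_closed(1)[OF iteration_add])

lemma add_zero [simp]: "a \<in> nats M \<Longrightarrow> a \<oplus> vempty M = a"
  by (simp add: nadd_result iteration.result_zero[OF iteration_add])

lemma add_vsucc [simp]: "a \<in> nats M \<Longrightarrow> b \<in> nats M \<Longrightarrow> a \<oplus> vsucc M b = vsucc M (a \<oplus> b)"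
  by (simp add: nadd_result iteration.result_vsucc[OF iteration_add])

lemma definable_term_add:
  assumes "definable_term M (nats M) s" "definable_term M (nats M) t"
  shows "definable_term M (nats M) (\<lambda>e. s e \<oplus> t e)"
proof (rule definable_term_graph2[where A = "\<lambda>x. x", OF add_closed _ _ _ _ assms])
  show "definable M (nats M) (\<lambda>e. e 2 = vsucc M (e 1))" by (intro nats_definable_rules)
  show "iterates M (\<lambda>x y. y = vsucc M x) a b r \<longleftrightarrow> r = a \<oplus> b" if "a \<in> nats M" "b \<in> nats M" for a b r
    using that by (simp add: nadd_result iteration.iterates_iff[OF iteration_add])
qed (simp_all add: definable_term_var)

lemma iteration_mul: "a \<in> nats M \<Longrightarrow> iteration M (\<lambda>x y. y = x \<oplus> a) (\<lambda>_. True) (vempty M)"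
  by unfold_locales (auto intro!: nats_definable_rules definable_term_add)

lemma nmul_result: "a \<in> nats M \<Longrightarrow> a \<otimes> b = iteration.result M (\<lambda>x y. y = x \<oplus> a) (vempty M) b"
  by (simp add: nmul_def iteration.result_def[OF iteration_mul])

lemma mul_closed [simp]: "a \<in> nats M \<Longrightarrow> b \<in> nats M \<Longrightarrow> a \<otimes> b \<in> nats M"
  by (simp add: nmul_result iteration.result_closed(1)[OF iteration_mul])

lemma mul_zero [simp]: "a \<in> nats M \<Longrightarrow> a \<otimes> vempty M = vempty M"
  by (simp add: nmul_result iteration.result_zero[OF iteration_mul])

lemma mul_vsucc [simp]: "a \<in> nats M \<Longrightarrow> b \<in> nats M \<Longrightarrow> a \<otimes> vsucc M b = a \<otimes> b \<oplus> a"
  by (simp add: nmul_result iteration.result_vsucc[OF iteration_mul])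

lemma definable_term_mul:
  assumes "definable_term M (nats M) s" "definable_term M (nats M) t"
  shows "definable_term M (nats M) (\<lambda>e. s e \<otimes> t e)"
proof (rule definable_term_graph2[where A = "\<lambda>_. vempty M", OF mul_closed _ _ _ _ assms])
  show "definable M (nats M) (\<lambda>e. e 2 = e 1 \<oplus> e 0)"
    by (intro nats_definable_rules definable_term_add)
  show "iterates M (\<lambda>x y. y = x \<oplus> a) (vempty M) b r \<longleftrightarrow> r = a \<otimes> b"
    if "a \<in> nats M" "b \<in> nats M" for a b r
    using that by (simp add: nmul_result iteration.iterates_iff[OF iteration_mul])
qed (simp_all add: definable_term_const quantifier_range_nats)

lemma iteration_pow: "a \<in> nats M \<Longrightarrow> iteration M (\<lambda>x y. y = x \<otimes> a) (\<lambda>_. True) (vsucc M (vempty M))"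
  by unfold_locales (auto intro!: nats_definable_rules definable_term_mul)

lemma npow_result: "a \<in> nats M \<Longrightarrow> a \<up> b = iteration.result M (\<lambda>x y. y = x \<otimes> a) (vsucc M (vempty M)) b"
  by (simp add: npow_def iteration.result_def[OF iteration_pow])

lemma pow_closed [simp]: "a \<in> nats M \<Longrightarrow> b \<in> nats M \<Longrightarrow> a \<up> b \<in> nats M"
  by (simp add: npow_result iteration.result_closed(1)[OF iteration_pow])

lemma pow_zero [simp]: "a \<in> nats M \<Longrightarrow> a \<up> vempty M = vsucc M (vempty M)"
  by (simp add: npow_result iteration.result_zero[OF iteration_pow])

lemma pow_vsucc [simp]: "a \<in> nats M \<Longrightarrow> b \<in> nats M \<Longrightarrow> a \<up> vsucc M b = (a \<up> b) \<otimes> a"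
  by (simp add: npow_result iteration.result_vsucc[OF iteration_pow])

lemma definable_term_pow:
  assumes "definable_term M (nats M) s" "definable_term M (nats M) t"
  shows "definable_term M (nats M) (\<lambda>e. s e \<up> t e)"
proof (rule definable_term_graph2[where A = "\<lambda>_. vsucc M (vempty M)", OF pow_closed _ _ _ _ assms])
  show "definable M (nats M) (\<lambda>e. e 2 = e 1 \<otimes> e 0)"
    by (intro nats_definable_rules definable_term_mul)
  show "iterates M (\<lambda>x y. y = x \<otimes> a) (vsucc M (vempty M)) b r \<longleftrightarrow> r = a \<up> b"
    if "a \<in> nats M" "b \<in> nats M" for a b r
    using that by (simp add: npow_result iteration.iterates_iff[OF iteration_pow])
qed (simp_all add: definable_term_const quantifier_range_nats)

lemmas arith_definable_rules =
  nats_definable_rules definable_term_add definable_term_mul definable_term_pow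


section \<open>Semiring laws and the law of exponents\<close>

lemma zero_add [simp]: "a \<in> nats M \<Longrightarrow> vempty M \<oplus> a = a"
  by (induction rule: nats_induct) (intro arith_definable_rules vempty_nat | simp)+

lemma vsucc_add [simp]:
  assumes a: "a \<in> nats M" and b: "b \<in> nats M" shows "vsucc M a \<oplus> b = vsucc M (a \<oplus> b)"
  using b
proof (induction rule: nats_induct)
  case definable
  show ?case by (intro arith_definable_rules vsucc_nat a)
qed (use a in simp_all)

lemma add_commute:
  assumes a: "a \<in> nats M" and b: "b \<in> nats M" shows "a \<oplus> b = b \<oplus> a"
  using b
proof (induction rule: nats_induct)
  case definable
  show ?case by (intro arith_definable_rules a)
qed (use a in simp_all)

lemma add_assoc:
  assumes a: "a \<in> nats M" and b: "b \<in> nats M" and c: "c \<in> nats M"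
  shows "(a \<oplus> b) \<oplus> c = a \<oplus> (b \<oplus> c)"
  using c
proof (induction rule: nats_induct)
  case definable
  show ?case by (intro arith_definable_rules a b)
qed (use a b in simp_all)

lemma add_left_commute:
  "a \<in> nats M \<Longrightarrow> b \<in> nats M \<Longrightarrow> c \<in> nats M \<Longrightarrow> a \<oplus> (b \<oplus> c) = b \<oplus> (a \<oplus> c)"
  using add_assoc[of a b c] add_assoc[of b a c] add_commute[of a b] by simp

lemmas add_ac = add_assoc add_commute add_left_commute

lemma zero_mul [simp]: "a \<in> nats M \<Longrightarrow> vempty M \<otimes> a = vempty M"
  by (induction rule: nats_induct) (intro arith_definable_rules vempty_nat | simp)+

lemma vsucc_mul [simp]:
  assumes a: "a \<in> nats M" and b: "b \<in> nats M" shows "vsucc M a \<otimes> b = a \<otimes> b \<oplus> b"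
  using b
proof (induction rule: nats_induct)
  case definable
  show ?case by (intro arith_definable_rules vsucc_nat a)
qed (use a in \<open>simp_all add: add_ac\<close>)

lemma mul_commute:
  assumes a: "a \<in> nats M" and b: "b \<in> nats M" shows "a \<otimes> b = b \<otimes> a"
  using b
proof (induction rule: nats_induct)
  case definable
  show ?case by (intro arith_definable_rules a)
qed (use a in simp_all)

lemma distrib_right:
  assumes a: "a \<in> nats M" and b: "b \<in> nats M" and c: "c \<in> nats M"
  shows "(a \<oplus> b) \<otimes> c = a \<otimes> c \<oplus> b \<otimes> c"
  using c
proof (induction rule: nats_induct)
  case definable
  show ?case by (intro arith_definable_rules a b)
qed (use a b in \<open>simp_all add: add_ac\<close>)

lemma distrib_left:
  "a \<in> nats M \<Longrightarrow> b \<in> nats M \<Longrightarrow> c \<in> nats M \<Longrightarrow> a \<otimes> (b \<oplus> c) = a \<otimes> b \<oplus> a \<otimes> c"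
  by (simp add: mul_commute[of a] distrib_right)

lemma mul_assoc:
  assumes a: "a \<in> nats M" and b: "b \<in> nats M" and c: "c \<in> nats M"
  shows "(a \<otimes> b) \<otimes> c = a \<otimes> (b \<otimes> c)"
  using c
proof (induction rule: nats_induct)
  case definable
  show ?case by (intro arith_definable_rules a b)
qed (use a b in \<open>simp_all add: distrib_left\<close>)

lemma mul_left_commute:
  "a \<in> nats M \<Longrightarrow> b \<in> nats M \<Longrightarrow> c \<in> nats M \<Longrightarrow> a \<otimes> (b \<otimes> c) = b \<otimes> (a \<otimes> c)"
  using mul_assoc[of a b c] mul_assoc[of b a c] mul_commute[of a b] by simp

lemmas arith_simps = add_ac mul_assoc mul_commute mul_left_commute distrib_left distrib_right

lemma pow_add:
  assumes a: "a \<in> nats M" and b: "b \<in> nats M" and c: "c \<in> nats M"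
  shows "a \<up> (b \<oplus> c) = (a \<up> b) \<otimes> (a \<up> c)"
  using c
proof (induction rule: nats_induct)
  case definable
  show ?case by (intro arith_definable_rules a b)
qed (use a b in \<open>simp_all add: mul_assoc\<close>)

section \<open>Order in terms of addition\<close>

lemma less_add_vsucc:
  assumes a: "a \<in> nats M" and c: "c \<in> nats M" shows "a \<prec> a \<oplus> vsucc M c"
  using c
proof (induction rule: nats_induct)
  case definable
  show ?case by (intro arith_definable_rules a)
qed (use a in \<open>simp_all add: less_vsucc\<close>)

lemma less_imp_add:
  assumes a: "a \<in> nats M" and b: "b \<in> nats M" shows "a \<prec> b \<longrightarrow> (\<exists>c\<in>nats M. b = a \<oplus> vsucc M c)"
  using b
proof (induction rule: nats_induct)
  case definable
  show ?case by (intro arith_definable_rules a)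
next
  case zero
  show ?case using vempty(2) a nats_dom by blast
next
  case (succ b)
  show ?case
  proof
    assume "a \<prec> vsucc M b"
    then consider "a \<prec> b" | "a = b" using less_vsucc a succ(1) by blast
    then show "\<exists>c\<in>nats M. vsucc M b = a \<oplus> vsucc M c"
    proof cases
      case 1
      then obtain c where "c \<in> nats M" "b = a \<oplus> vsucc M c" using succ by blast
      then show ?thesis using a by (intro bexI[of _ "vsucc M c"]) auto
    next
      case 2
      then show ?thesis using a by (intro bexI[of _ "vempty M"]) auto
    qed
  qed
qed

lemma lessE:
  assumes "a \<prec> b" "a \<in> nats M" "b \<in> nats M"
  obtains c where "c \<in> nats M" "b = a \<oplus> vsucc M c"
  using less_imp_add assms by blast

lemma less_asym: "a \<in> nats M \<Longrightarrow> b \<in> nats M \<Longrightarrow> a \<prec> b \<Longrightarrow> \<not> b \<prec> a"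
  using less_trans less_irrefl by blast

lemma less_add_mono:
  assumes "a \<prec> b" "a \<in> nats M" "b \<in> nats M" "c \<in> nats M" shows "a \<oplus> c \<prec> b \<oplus> c"
proof -
  obtain d where d: "d \<in> nats M" "b = a \<oplus> vsucc M d" using assms(1-3) by (rule lessE)
  have "a \<oplus> c \<prec> (a \<oplus> c) \<oplus> vsucc M d" using assms d by (intro less_add_vsucc) auto
  then show ?thesis using assms d by (simp add: add_ac)
qed

lemma add_right_cancel:
  "a \<in> nats M \<Longrightarrow> b \<in> nats M \<Longrightarrow> c \<in> nats M \<Longrightarrow> a \<oplus> c = b \<oplus> c \<longleftrightarrow> a = b"
  using less_linear[of a b] less_add_mono[of a b c] less_add_mono[of b a c] less_irrefl[of "b \<oplus> c"]
  by auto

lemma le_add: "a \<in> nats M \<Longrightarrow> b \<in> nats M \<Longrightarrow> a \<prec> vsucc M (a \<oplus> b)"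
  using less_add_vsucc by simp

text \<open>A digit below k appended to q does not overflow: if m = q + c + 1 and k = r + d + 1, the
  gap is c k + d + 1.\<close>

lemma mul_add_less:
  assumes "q \<prec> m" "r \<prec> k" "q \<in> nats M" "m \<in> nats M" "r \<in> nats M" "k \<in> nats M"
  shows "q \<otimes> k \<oplus> r \<prec> m \<otimes> k"
proof -
  obtain c where c: "c \<in> nats M" "m = q \<oplus> vsucc M c" using assms(1,3,4) by (rule lessE)
  obtain d where d: "d \<in> nats M" "k = r \<oplus> vsucc M d" using assms(2,5,6) by (rule lessE)
  have "m \<otimes> k = q \<otimes> k \<oplus> (c \<otimes> k \<oplus> k)" using c assms by (simp add: arith_simps)
  also have "\<dots> = q \<otimes> k \<oplus> (c \<otimes> k \<oplus> (r \<oplus> vsucc M d))" using d(2) by simp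
  also have "\<dots> = (q \<otimes> k \<oplus> r) \<oplus> vsucc M (c \<otimes> k \<oplus> d)" using c(1) d(1) assms by (simp add: add_ac)
  finally show ?thesis using c(1) d(1) assms by (simp only: less_add_vsucc add_closed mul_closed)
qed

text \<open>Bounds the leading part of a number by a bound on the whole; this is how the fields of
  an instruction inherit their bounds.\<close>

lemma less_of_mul_add_less:
  assumes "q \<otimes> k \<oplus> r \<prec> m \<otimes> k" "q \<in> nats M" "m \<in> nats M" "r \<in> nats M" "k \<in> nats M"
  shows "q \<prec> m"
proof (rule ccontr)
  assume "\<not> q \<prec> m"
  then have "m = q \<or> m \<prec> q" using less_linear assms by blast
  then obtain c where c: "c \<in> nats M" "q = m \<oplus> c"
  proof (elim disjE)
    assume "m \<prec> q"
    then obtain c where "c \<in> nats M" "q = m \<oplus> vsucc M c" using assms by (auto elim: lessE)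
    then show ?thesis using that[of "vsucc M c"] by simp
  qed (use that[of "vempty M"] assms in simp)
  have "m \<otimes> k \<prec> vsucc M (m \<otimes> k \<oplus> (c \<otimes> k \<oplus> r))" using c assms by (intro le_add) auto
  also have "m \<otimes> k \<oplus> (c \<otimes> k \<oplus> r) = q \<otimes> k \<oplus> r" using c assms by (simp add: arith_simps)
  finally have "m \<otimes> k \<prec> q \<otimes> k \<oplus> r \<or> m \<otimes> k = q \<otimes> k \<oplus> r" using assms by (simp add: less_vsucc)
  then show False using assms less_asym[of "m \<otimes> k" "q \<otimes> k \<oplus> r"] less_irrefl[of "m \<otimes> k"] by auto
qed

section \<open>Division with remainder\<close>

lemma divide_unique:
  assumes "q \<otimes> k \<oplus> r = q' \<otimes> k \<oplus> r'" "r \<prec> k" "r' \<prec> k"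
    and N: "q \<in> nats M" "q' \<in> nats M" "r \<in> nats M" "r' \<in> nats M" "k \<in> nats M"
  shows "q = q' \<and> r = r'"
proof -
  have le: "\<not> q \<prec> q'" if "q \<otimes> k \<oplus> r = q' \<otimes> k \<oplus> r'" "r \<prec> k"
      "q \<in> nats M" "q' \<in> nats M" "r \<in> nats M" "r' \<in> nats M" for q q' r r'
  proof
    assume "q \<prec> q'"
    then have 1: "q' \<otimes> k \<oplus> r' \<prec> q' \<otimes> k" using mul_add_less[of q q' r k] that N(5) by simp
    from less_of_mul_add_less[OF this] have "q' \<prec> q'" using that N(5) by simp
    then show False using less_irrefl that by blast
  qed
  have "q = q'" using le[of q r q' r'] le[of q' r' q r] assms less_linear[of q q'] by auto
  then show ?thesis using assms add_right_cancel[of r r' "q \<otimes> k"] by (simp add: add_commute)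
qed

lemma divide_exists:
  assumes k: "vempty M \<prec> k" "k \<in> nats M" and x: "x \<in> nats M"
  shows "\<exists>q\<in>nats M. \<exists>r\<in>nats M. r \<prec> k \<and> x = q \<otimes> k \<oplus> r"
  using x
proof (induction rule: nats_induct)
  case definable
  show ?case by (intro arith_definable_rules k)
next
  case zero
  show ?case using k by (intro bexI[of _ "vempty M"]) auto
next
  case (succ x)
  then obtain q r where qr: "q \<in> nats M" "r \<in> nats M" "r \<prec> k" "x = q \<otimes> k \<oplus> r" by blast
  have "vsucc M r \<prec> k \<or> vsucc M r = k" using vsucc_le qr k by blast
  then show ?case
  proof
    assume "vsucc M r \<prec> k"
    then show ?thesis using qr k by (intro bexI[of _ q] bexI[of _ "vsucc M r"]) auto
  next
    assume r: "vsucc M r = k"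
    have "vsucc M x = q \<otimes> k \<oplus> vsucc M r" using qr k by simp
    then have "vsucc M x = vsucc M q \<otimes> k \<oplus> vempty M" unfolding r using qr k by simp
    then show ?thesis using qr k by (intro bexI[of _ "vsucc M q"] bexI[of _ "vempty M"]) auto
  qed
qed

lemma mul_pos:
  assumes "vempty M \<prec> a" "vempty M \<prec> b" "a \<in> nats M" "b \<in> nats M" shows "vempty M \<prec> a \<otimes> b"
  using mul_add_less[of "vempty M" a "vempty M" b] assms by simp

lemma pow_pos:
  assumes b: "vempty M \<prec> b" "b \<in> nats M" and i: "i \<in> nats M" shows "vempty M \<prec> b \<up> i"
  using i
proof (induction rule: nats_induct)
  case definable
  show ?case by (intro arith_definable_rules b vempty_nat)
qed (use b zero_less_vsucc in \<open>simp_all add: mul_pos\<close>)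

section \<open>Codes of tuples, and digits\<close>

lemma cpair_closed [simp]: "x \<in> nats M \<Longrightarrow> y \<in> nats M \<Longrightarrow> cpair M x y \<in> nats M"
  by (simp add: cpair_def)

text \<open>With s = x + y the code lies between s^2 and s^2 + s, hence below (s + 1)^2. So it
  determines s, then x, then y.\<close>

lemma cpair_inj:
  assumes "cpair M x y = cpair M x' y'" "x \<in> nats M" "y \<in> nats M" "x' \<in> nats M" "y' \<in> nats M"
  shows "x = x' \<and> y = y'"
proof -
  have le: "\<not> x \<oplus> y \<prec> x' \<oplus> y'" if eq: "cpair M x y = cpair M x' y'"
    and N: "x \<in> nats M" "y \<in> nats M" "x' \<in> nats M" "y' \<in> nats M" for x y x' y'
  proof
    let ?s = "x \<oplus> y"
    assume "x \<oplus> y \<prec> x' \<oplus> y'"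
    then obtain c where c: "c \<in> nats M" "x' \<oplus> y' = ?s \<oplus> vsucc M c" using N by (auto elim: lessE)
    have "?s \<otimes> ?s \<oplus> x = (?s \<oplus> vsucc M c) \<otimes> (?s \<oplus> vsucc M c) \<oplus> x'"
      using eq c(2) by (simp add: cpair_def)
    also have "\<dots> = (?s \<otimes> ?s \<oplus> x) \<oplus> vsucc M (x' \<oplus> y \<oplus> ?s \<oplus> ?s \<otimes> c \<oplus> ?s \<otimes> c \<oplus> c \<oplus> c \<oplus> c \<otimes> c)"
    proof -
      \<comment> \<open>A variable s in place of x + y keeps the sum from being multiplied out.
        Afterwards one of the two summands s is opened to release the x of the smaller code.\<close>
      have "(s \<oplus> vsucc M c) \<otimes> (s \<oplus> vsucc M c) \<oplus> x' =
          (s \<otimes> s) \<oplus> vsucc M (x' \<oplus> s \<oplus> s \<oplus> s \<otimes> c \<oplus> s \<otimes> c \<oplus> c \<oplus> c \<oplus> c \<otimes> c)" if "s \<in> nats M" for s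
        using that c(1) N by (simp add: arith_simps)
      from this[of ?s] have "(?s \<oplus> vsucc M c) \<otimes> (?s \<oplus> vsucc M c) \<oplus> x' =
          (?s \<otimes> ?s) \<oplus> vsucc M (x' \<oplus> (x \<oplus> y) \<oplus> ?s \<oplus> ?s \<otimes> c \<oplus> ?s \<otimes> c \<oplus> c \<oplus> c \<oplus> c \<otimes> c)" using N by simp
      also have "\<dots> = (?s \<otimes> ?s \<oplus> x) \<oplus> vsucc M (x' \<oplus> y \<oplus> ?s \<oplus> ?s \<otimes> c \<oplus> ?s \<otimes> c \<oplus> c \<oplus> c \<oplus> c \<otimes> c)"
        using N c(1) by (simp add: add_ac)
      finally show ?thesis .
    qed
    finally show False
      using less_add_vsucc[of "?s \<otimes> ?s \<oplus> x" "x' \<oplus> y \<oplus> ?s \<oplus> ?s \<otimes> c \<oplus> ?s \<otimes> c \<oplus> c \<oplus> c \<oplus> c \<otimes> c"]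
        less_irrefl[of "?s \<otimes> ?s \<oplus> x"] N c(1) by simp
  qed
  have eq: "x \<oplus> y = x' \<oplus> y'"
    using le[OF assms] le[OF assms(1)[symmetric] assms(4,5,2,3)] less_linear assms by (meson add_closed)
  then have "x = x'"
    using assms(1) add_right_cancel[of x x' "(x \<oplus> y) \<otimes> (x \<oplus> y)"] assms(2-) by (simp add: cpair_def add_commute)
  then show ?thesis using eq add_right_cancel[of y y' x] assms by (simp add: add_commute)
qed

lemma ctriple_closed [simp]: "x \<in> nats M \<Longrightarrow> y \<in> nats M \<Longrightarrow> z \<in> nats M \<Longrightarrow> ctriple M x y z \<in> nats M"
  by (simp add: ctriple_def)

lemma ctriple_inj:
  assumes "ctriple M x y z = ctriple M x' y' z'" "x \<in> nats M" "y \<in> nats M" "z \<in> nats M"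
    "x' \<in> nats M" "y' \<in> nats M" "z' \<in> nats M"
  shows "x = x' \<and> y = y' \<and> z = z'"
  using assms cpair_inj[of x "cpair M y z" x' "cpair M y' z'"] cpair_inj[of y z y' z']
  by (simp add: ctriple_def)

lemma is_digit_unique:
  assumes "is_digit M b t i d" "is_digit M b t i d'" "b \<in> nats M" "i \<in> nats M" "d \<in> nats M" "d' \<in> nats M"
  shows "d = d'"
proof -
  obtain u v u' v' where *: "d \<prec> b" "d' \<prec> b" "u \<in> nats M" "v \<in> nats M" "u' \<in> nats M" "v' \<in> nats M"
    "v \<prec> b \<up> i" "v' \<prec> b \<up> i" "t = (u \<otimes> b \<oplus> d) \<otimes> (b \<up> i) \<oplus> v" "t = (u' \<otimes> b \<oplus> d') \<otimes> (b \<up> i) \<oplus> v'"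
    using assms(1,2) unfolding is_digit_def by blast
  then have "u \<otimes> b \<oplus> d = u' \<otimes> b \<oplus> d'"
    using divide_unique[of "u \<otimes> b \<oplus> d" "b \<up> i" v "u' \<otimes> b \<oplus> d'" v'] assms(3-) by simp
  then show ?thesis using divide_unique[of u b d u' d'] * assms(3-) by simp
qed

lemma ex_digit:
  assumes b: "vempty M \<prec> b" "b \<in> nats M" and t: "t \<in> nats M" and i: "i \<in> nats M"
  shows "\<exists>d\<in>nats M. is_digit M b t i d"
proof -
  obtain w v where wv: "w \<in> nats M" "v \<in> nats M" "v \<prec> b \<up> i" "t = w \<otimes> (b \<up> i) \<oplus> v"
    using divide_exists[OF pow_pos[OF b i] _ t] b i by auto
  moreover obtain u d where "u \<in> nats M" "d \<in> nats M" "d \<prec> b" "w = u \<otimes> b \<oplus> d"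
    using divide_exists[OF b wv(1)] by blast
  ultimately show ?thesis unfolding is_digit_def by blast
qed

end

section \<open>Sequences coded as digits of one number\<close>

context zf
begin

text \<open>Provides the base for \<open>ex_code\<close>. The segment may be infinite when seen from
  outside, so the bound is found by induction in M.\<close>

lemma bounded_on_initial_segment:
  assumes F: "\<And>x. x \<in> nats M \<Longrightarrow> F x \<in> nats M"
    and F_def: "\<And>i. definable_term M (nats M) (\<lambda>e. F (e i))" and z: "z \<in> nats M"
  shows "\<exists>B\<in>nats M. \<forall>i\<in>nats M. i \<prec> z \<longrightarrow> F i \<prec> B"
  using z
proof (induction rule: nats_induct)
  case definable
  show ?case by (intro arith_definable_rules F_def)
next
  case zero
  show ?case using vempty nats_dom vempty_nat by blast
next
  case (succ z)
  then obtain B where B: "B \<in> nats M" "\<And>i. i \<in> nats M \<Longrightarrow> i \<prec> z \<Longrightarrow> F i \<prec> B" by blast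
  have "F i \<prec> B \<oplus> vsucc M (F z)" if i: "i \<in> nats M" "i \<prec> vsucc M z" for i
  proof -
    consider "i \<prec> z" | "i = z" using i succ(1) less_vsucc by blast
    then show ?thesis
    proof cases
      case 1
      then show ?thesis
        using B i F succ(1) less_trans[of "B \<oplus> vsucc M (F z)" B "F i"] less_add_vsucc by simp
    next
      case 2
      then show ?thesis
        using le_add[of "F z" B] B(1) F[OF succ(1)] by (simp add: add_commute)
    qed
  qed
  then show ?case using B(1) F[OF succ(1)] by (intro bexI[of _ "B \<oplus> vsucc M (F z)"]) auto
qed

text \<open>Digits are added at the top: the code of j + 1 values is F j B^j + c, where c codes the
  first j. The invariant c < B^j makes c a proper remainder below the new digit.\<close>

lemma ex_code:
  assumes F: "\<And>x. x \<in> nats M \<Longrightarrow> F x \<in> nats M"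
    and F_def: "\<And>i. definable_term M (nats M) (\<lambda>e. F (e i))" and z: "z \<in> nats M"
  shows "\<exists>B\<in>nats M. \<exists>c\<in>nats M. \<forall>i\<in>nats M. i \<prec> z \<longrightarrow> is_digit M B c i (F i)"
proof -
  obtain B where B: "B \<in> nats M" "\<And>i. i \<in> nats M \<Longrightarrow> i \<prec> z \<Longrightarrow> F i \<prec> B"
    using bounded_on_initial_segment[OF F F_def z] by blast
  \<comment> \<open>The guard says j \<le> z: the values of F are known to be below B only at
    arguments below z.\<close>
  have "\<exists>c\<in>nats M. j \<prec> vsucc M z \<longrightarrow>
      c \<prec> B \<up> j \<and> (\<forall>i\<in>nats M. i \<prec> j \<longrightarrow> is_digit M B c i (F i))" if "j \<in> nats M" for j
    using that
  proof (induction rule: nats_induct)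
    case definable
    show ?case unfolding is_digit_def by (intro arith_definable_rules F_def vsucc_nat z B(1))
  next
    case zero
    have "\<not> i \<prec> vempty M" if "i \<in> nats M" for i using that vempty nats_dom by blast
    then show ?case using B(1) by (intro bexI[of _ "vempty M"]) (auto simp: less_vsucc)
  next
    case (succ j)
    then obtain c where c: "c \<in> nats M" "j \<prec> vsucc M z \<longrightarrow>
      c \<prec> B \<up> j \<and> (\<forall>i\<in>nats M. i \<prec> j \<longrightarrow> is_digit M B c i (F i))" by blast
    note Fj = F[OF succ(1)]
    show ?case
    proof (intro bexI[of _ "F j \<otimes> (B \<up> j) \<oplus> c"] impI conjI ballI)
      assume "vsucc M j \<prec> vsucc M z"
      then have jz: "j \<prec> z" using less_of_vsucc_less succ(1) z by blast
      then have cB: "c \<prec> B \<up> j" and dig: "\<And>i. i \<in> nats M \<Longrightarrow> i \<prec> j \<Longrightarrow> is_digit M B c i (F i)"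
        using c succ(1) z by (auto simp: less_vsucc)
      show "F j \<otimes> (B \<up> j) \<oplus> c \<prec> B \<up> vsucc M j"
        using mul_add_less[OF B(2)[OF succ(1) jz] cB] Fj B(1) c(1) succ(1)
        by (simp add: mul_commute[of _ B])
      fix i assume i: "i \<in> nats M" "i \<prec> vsucc M j"
      then consider "i = j" | "i \<prec> j" using less_vsucc succ(1) by blast
      then show "is_digit M B (F j \<otimes> (B \<up> j) \<oplus> c) i (F i)"
      proof cases
        case 1
        \<comment> \<open>Nothing stands above the new top digit, and all of c stands below
          it.\<close>
        then show ?thesis unfolding is_digit_def
          using B cB jz Fj c(1) succ(1) by (intro conjI bexI[of _ "vempty M"] bexI[of _ c]) auto
      next
        case 2
        obtain e where e: "e \<in> nats M" "j = i \<oplus> vsucc M e" using 2 i succ(1) by (auto elim: lessE)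
        obtain u v where uv: "F i \<prec> B" "u \<in> nats M" "v \<in> nats M" "v \<prec> B \<up> i"
          "c = (u \<otimes> B \<oplus> F i) \<otimes> (B \<up> i) \<oplus> v"
          using dig[OF i(1) 2] unfolding is_digit_def by blast
        have Fi: "F i \<in> nats M" using F i by blast
        \<comment> \<open>B^j is a multiple of B^(i + 1), so the new summand changes only the part u
          above digit i.\<close>
        have Bj: "B \<up> j = (B \<up> i) \<otimes> ((B \<up> e) \<otimes> B)" using e i B(1) by (simp add: pow_add mul_assoc)
        have "F j \<otimes> (B \<up> j) \<oplus> c = ((F j \<otimes> (B \<up> e) \<oplus> u) \<otimes> B \<oplus> F i) \<otimes> (B \<up> i) \<oplus> v"
          unfolding Bj uv(5) using Fj Fi uv(2,3) e(1) i(1) B(1) by (simp add: arith_simps)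
        then show ?thesis unfolding is_digit_def
          using uv(1-4) Fj e(1) B(1)
          by (intro conjI bexI[of _ "F j \<otimes> (B \<up> e) \<oplus> u"] bexI[of _ v]) auto
      qed
    qed (use Fj B(1) c(1) succ(1) in simp)
  qed
  from this[OF z] show ?thesis using B(1) z less_vsucc by blast
qed

end

subsection \<open>Turing machines\<close>

locale turing = zf +
  fixes T n k t :: 'a
  assumes code: "codes_tm M T n k t"
begin

lemma nkt [simp]: "n \<in> nats M" "k \<in> nats M" "t \<in> nats M"
  using code by (auto simp: codes_tm_def)

lemma n_pos: "vempty M \<prec> n"
  using code by (simp add: codes_tm_def n_zero_def)

lemma k_pos: "vempty M \<prec> k"
  using code less_trans[of k "vsucc M (vempty M)" "vempty M"] by (simp add: codes_tm_def n_one_def less_vsucc)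

lemma nthree_eq: "nthree M = vsucc M (vsucc M (vsucc M (vempty M)))"
  by (simp add: nthree_def ntwo_def n_one_def)

lemma ntwo_eq: "ntwo M = vsucc M (vsucc M (vempty M))"
  by (simp add: ntwo_def n_one_def)

lemma nthree_nat [simp]: "nthree M \<in> nats M"
  by (simp add: nthree_eq)

lemma nthree_pos: "vempty M \<prec> nthree M"
  by (simp add: nthree_eq zero_less_vsucc)

lemma less_three: "m \<in> nats M \<Longrightarrow> m \<prec> nthree M \<longleftrightarrow> m = \<zero> \<or> m = \<one> \<or> m = ntwo M"
  using vempty(2)[of m] nats_dom[of m] by (auto simp: nthree_eq ntwo_eq n_zero_def n_one_def less_vsucc)

lemma zero_one_two_distinct: "\<zero> \<noteq> \<one>" "\<zero> \<noteq> ntwo M" "\<one> \<noteq> ntwo M"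
  using vsucc_nonzero[of "vempty M"] vsucc_nonzero[of "vsucc M (vempty M)"]
  by (auto simp: n_zero_def n_one_def ntwo_eq vsucc_inj)

lemma tm_base_nat [simp]: "tm_base M n k \<in> nats M"
  by (simp add: tm_base_def n_one_def)

text \<open>Grouped in this way, the base matches the decoding of an instruction: division by 3
  splits off the move, division by k the symbol, and n + 1 bounds the state.\<close>

lemma tm_base_eq: "tm_base M n k = (vsucc M n \<otimes> k) \<otimes> nthree M"
proof -
  have "tm_base M n k = (nthree M \<otimes> k) \<otimes> vsucc M n" by (simp add: tm_base_def n_one_def)
  also have "\<dots> = (vsucc M n \<otimes> k) \<otimes> nthree M"
    using mul_assoc[of "vsucc M n" k "nthree M"] mul_commute[of "nthree M" k]
      mul_commute[of "k \<otimes> nthree M" "vsucc M n"] by (simp del: vsucc_mul mul_vsucc)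
  finally show ?thesis .
qed

lemma tm_base_pos: "vempty M \<prec> tm_base M n k"
  unfolding tm_base_eq using k_pos nthree_pos zero_less_vsucc[of n]
  by (intro mul_pos) (simp_all del: vsucc_mul)

text \<open>The working branch of \<open>tm_step\<close> with all its witnesses as arguments, so
  that they can be compared in \<open>move_unique\<close> and mapped by f later.\<close>

definition move :: "'a \<Rightarrow> 'a \<Rightarrow> 'a \<Rightarrow> 'a \<Rightarrow> 'a \<Rightarrow> 'a \<Rightarrow> 'a \<Rightarrow> 'a \<Rightarrow> 'a \<Rightarrow> 'a \<Rightarrow> 'a \<Rightarrow> bool" where
  "move q l r a r0 q' a' m l' r' s' \<longleftrightarrow>
     a \<prec> k \<and> r = r0 \<otimes> k \<oplus> a \<and> (q' \<prec> n \<or> q' = n) \<and> a' \<prec> k \<and> m \<prec> nthree M \<and>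
     is_digit M (tm_base M n k) t (q \<otimes> k \<oplus> a) ((q' \<otimes> k \<oplus> a') \<otimes> nthree M \<oplus> m) \<and>
     tape_move M k m l a' r0 l' r' \<and> s' = ctriple M q' l' r'"

text \<open>\<open>tm_step\<close> quantifies over n, k, t with code T; injectivity of
  \<open>ctriple\<close> leaves those fixed by the locale as the only choice.\<close>

lemma tm_step_iff:
  "tm_step M T s s' \<longleftrightarrow> (\<exists>q\<in>nats M. \<exists>l\<in>nats M. \<exists>r\<in>nats M. s = ctriple M q l r \<and>
     (q = n \<and> s' = s \<or> q \<prec> n \<and>
       (\<exists>a\<in>nats M. \<exists>r0\<in>nats M. \<exists>q'\<in>nats M. \<exists>a'\<in>nats M. \<exists>m\<in>nats M. \<exists>l'\<in>nats M. \<exists>r'\<in>nats M.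
          move q l r a r0 q' a' m l' r' s')))"
proof -
  have unique: "n' = n \<and> k' = k \<and> t' = t" if "codes_tm M T n' k' t'" for n' k' t'
    using that code ctriple_inj[of n' k' t' n k t] by (auto simp: codes_tm_def)
  have "(\<exists>n' k' t'. codes_tm M T n' k' t' \<and> P n' k' t') \<longleftrightarrow> P n k t" for P
    using unique code by blast
  then show ?thesis unfolding tm_step_def move_def by (simp only: bex_simps conj_assoc)
qed

text \<open>The invariant of a run. Every number is a legal half-tape in base k, so only the state
  component has to be bounded; a code with q > n has no successor.\<close>

definition valid :: "'a \<Rightarrow> bool" where
  "valid s \<longleftrightarrow> (\<exists>q\<in>nats M. \<exists>l\<in>nats M. \<exists>r\<in>nats M. s = ctriple M q l r \<and> (q \<prec> n \<or> q = n))"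

lemma definable_term_ctriple:
  "definable_term M (nats M) x \<Longrightarrow> definable_term M (nats M) y \<Longrightarrow> definable_term M (nats M) z \<Longrightarrow>
    definable_term M (nats M) (\<lambda>e. ctriple M (x e) (y e) (z e))"
  unfolding ctriple_def cpair_def by (intro definable_term_add definable_term_mul)

text \<open>Every digit below the base is an instruction: two divisions extract the fields, and two
  applications of \<open>less_of_mul_add_less\<close> bound the new state by n.\<close>

lemma digit_total:
  assumes "q \<in> nats M" "a \<in> nats M"
  shows "\<exists>q'\<in>nats M. \<exists>a'\<in>nats M. \<exists>m\<in>nats M. (q' \<prec> n \<or> q' = n) \<and> a' \<prec> k \<and> m \<prec> nthree M \<and>
     is_digit M (tm_base M n k) t (q \<otimes> k \<oplus> a) ((q' \<otimes> k \<oplus> a') \<otimes> nthree M \<oplus> m)"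
proof -
  obtain d where d: "d \<in> nats M" "is_digit M (tm_base M n k) t (q \<otimes> k \<oplus> a) d"
    using ex_digit[OF tm_base_pos, of t "q \<otimes> k \<oplus> a"] assms by auto
  obtain x m where xm: "x \<in> nats M" "m \<in> nats M" "m \<prec> nthree M" "d = x \<otimes> nthree M \<oplus> m"
    using divide_exists[OF nthree_pos _ d(1)] by auto
  obtain q' a' where qa: "q' \<in> nats M" "a' \<in> nats M" "a' \<prec> k" "x = q' \<otimes> k \<oplus> a'"
    using divide_exists[OF k_pos _ xm(1)] by auto
  have "d \<prec> (vsucc M n \<otimes> k) \<otimes> nthree M" using d(2) unfolding is_digit_def tm_base_eq by blast
  then have "x \<prec> vsucc M n \<otimes> k"
    using less_of_mul_add_less[of x "nthree M" m "vsucc M n \<otimes> k"] xm by (simp del: vsucc_mul)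
  then have "q' \<prec> vsucc M n"
    using less_of_mul_add_less[of q' k a' "vsucc M n"] qa by (simp del: vsucc_mul)
  then have "q' \<prec> n \<or> q' = n" using qa less_vsucc by simp
  then show ?thesis using xm qa d(2) by blast
qed

lemma tape_move_total:
  assumes "m \<in> nats M" "m \<prec> nthree M" "l \<in> nats M" "a' \<in> nats M" "r0 \<in> nats M"
  shows "\<exists>l'\<in>nats M. \<exists>r'\<in>nats M. tape_move M k m l a' r0 l' r'"
proof -
  obtain q c where qc: "q \<in> nats M" "c \<in> nats M" "c \<prec> k" "l = q \<otimes> k \<oplus> c"
    using divide_exists[OF k_pos _ assms(3)] by auto
  consider "m = \<zero>" | "m = \<one>" | "m = ntwo M" using less_three assms by blast
  then show ?thesis
  proof cases
    case 1
    then show ?thesis unfolding tape_move_def using assms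
      by (intro bexI[of _ l] bexI[of _ "r0 \<otimes> k \<oplus> a'"]) auto
  next
    case 2
    then show ?thesis unfolding tape_move_def using assms qc
      by (intro bexI[of _ q] bexI[of _ "(r0 \<otimes> k \<oplus> a') \<otimes> k \<oplus> c"]) auto
  next
    case 3
    then show ?thesis unfolding tape_move_def using assms
      by (intro bexI[of _ "l \<otimes> k \<oplus> a'"] bexI[of _ r0]) auto
  qed
qed

lemma tape_move_unique:
  assumes mv: "tape_move M k m l a' r0 l1 r1" "tape_move M k m l a' r0 l2 r2"
    and "l1 \<in> nats M" "l2 \<in> nats M"
  shows "l1 = l2 \<and> r1 = r2"
proof (cases "m = \<one>")
  case True
  then obtain c c' where c: "c \<in> nats M" "c \<prec> k" "l = l1 \<otimes> k \<oplus> c" "r1 = (r0 \<otimes> k \<oplus> a') \<otimes> k \<oplus> c"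
    "c' \<in> nats M" "c' \<prec> k" "l = l2 \<otimes> k \<oplus> c'" "r2 = (r0 \<otimes> k \<oplus> a') \<otimes> k \<oplus> c'"
    using mv zero_one_two_distinct unfolding tape_move_def by auto
  then have "l1 = l2 \<and> c = c'"
    using divide_unique[of l1 k c l2 c'] assms(3,4) by simp
  then show ?thesis using c by simp
next
  case False
  then show ?thesis using mv zero_one_two_distinct unfolding tape_move_def by auto
qed

text \<open>Each witness is the quotient or remainder of something already determined: the scanned
  symbol, the table digit, its three fields, and for a left move the cell taken from l.\<close>

lemma move_unique:
  assumes mv: "move q l r a r0 q' a' m l' r' s'" "move q l r b u0 p' b' j x' y' s''"
    and N: "q \<in> nats M" "a \<in> nats M" "r0 \<in> nats M" "q' \<in> nats M" "a' \<in> nats M" "m \<in> nats M" "l' \<in> nats M"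
     "b \<in> nats M" "u0 \<in> nats M" "p' \<in> nats M" "b' \<in> nats M" "j \<in> nats M" "x' \<in> nats M"
  shows "s' = s''"
proof -
  have 1: "r0 = u0 \<and> a = b"
    using divide_unique[of r0 k a u0 b] mv N unfolding move_def by simp
  have "(q' \<otimes> k \<oplus> a') \<otimes> nthree M \<oplus> m = (p' \<otimes> k \<oplus> b') \<otimes> nthree M \<oplus> j"
    using is_digit_unique[of "tm_base M n k" t "q \<otimes> k \<oplus> a"] mv N 1 unfolding move_def by simp
  then have 2: "q' \<otimes> k \<oplus> a' = p' \<otimes> k \<oplus> b' \<and> m = j"
    using mv N unfolding move_def
    by (intro divide_unique[of "q' \<otimes> k \<oplus> a'" "nthree M" m "p' \<otimes> k \<oplus> b'" j]) simp_all
  then have 3: "q' = p' \<and> a' = b'"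
    using mv N unfolding move_def by (intro divide_unique[of q' k a' p' b']) simp_all
  have "l' = x' \<and> r' = y'"
    using mv N 1 2 3 unfolding move_def by (intro tape_move_unique[of m l a' r0]) simp_all
  then show ?thesis using mv 3 unfolding move_def by simp
qed

lemma tm_step_halt:
  "l \<in> nats M \<Longrightarrow> r \<in> nats M \<Longrightarrow> tm_step M T (ctriple M n l r) (ctriple M n l r)"
  unfolding tm_step_iff by (intro bexI[of _ n] bexI[of _ l] bexI[of _ r]) simp_all

lemma tm_step_move:
  assumes "move q l r a r0 q' a' m l' r' y" "q \<prec> n" and N: "q \<in> nats M" "l \<in> nats M" "r \<in> nats M"
    "a \<in> nats M" "r0 \<in> nats M" "q' \<in> nats M" "a' \<in> nats M" "m \<in> nats M" "l' \<in> nats M" "r' \<in> nats M"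
  shows "tm_step M T (ctriple M q l r) y"
  unfolding tm_step_iff
  by (rule bexI[OF _ N(1)], rule bexI[OF _ N(2)], rule bexI[OF _ N(3)], rule conjI[OF refl], rule disjI2,
      rule conjI[OF assms(2)]) (use assms(1) N in blast)

lemma tm_step_cases:
  assumes step: "tm_step M T (ctriple M q l r) y" and N: "q \<in> nats M" "l \<in> nats M" "r \<in> nats M"
  obtains (halt) "q = n" "y = ctriple M q l r"
  | (move) a r0 q' a' m l' r' where "q \<prec> n" "a \<in> nats M" "r0 \<in> nats M" "q' \<in> nats M" "a' \<in> nats M"
      "m \<in> nats M" "l' \<in> nats M" "r' \<in> nats M" "move q l r a r0 q' a' m l' r' y"
  using step[unfolded tm_step_iff]
proof (elim bexE conjE)
  fix q1 l1 r1
  assume 1: "q1 \<in> nats M" "l1 \<in> nats M" "r1 \<in> nats M" "ctriple M q l r = ctriple M q1 l1 r1"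
    and step1: "q1 = n \<and> y = ctriple M q l r \<or> q1 \<prec> n \<and>
       (\<exists>a\<in>nats M. \<exists>r0\<in>nats M. \<exists>q'\<in>nats M. \<exists>a'\<in>nats M. \<exists>m\<in>nats M. \<exists>l'\<in>nats M. \<exists>r'\<in>nats M.
          move q1 l1 r1 a r0 q' a' m l' r' y)"
  have "q1 = q" "l1 = l" "r1 = r" using ctriple_inj[OF 1(4) N 1(1-3)] by simp_all
  with step1 have "q = n \<and> y = ctriple M q l r \<or> q \<prec> n \<and>
       (\<exists>a\<in>nats M. \<exists>r0\<in>nats M. \<exists>q'\<in>nats M. \<exists>a'\<in>nats M. \<exists>m\<in>nats M. \<exists>l'\<in>nats M. \<exists>r'\<in>nats M.
          move q l r a r0 q' a' m l' r' y)" by (simp only:)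
  then show thesis
  proof (elim disjE conjE bexE)
    assume "q = n" "y = ctriple M q l r"
    then show thesis by (rule halt)
  next
    fix a r0 q' a' m l' r'
    assume "q \<prec> n" "a \<in> nats M" "r0 \<in> nats M" "q' \<in> nats M" "a' \<in> nats M"
      "m \<in> nats M" "l' \<in> nats M" "r' \<in> nats M" "move q l r a r0 q' a' m l' r' y"
    then show thesis by (rule move)
  qed
qed

text \<open>Totality: a halted state repeats itself, and below n the table always provides an
  instruction and a resulting tape. Determinism: the two branches exclude each other because n < n
  fails, and \<open>move_unique\<close> settles the working branch.\<close>

lemma tm_iteration: "iteration M (tm_step M T) valid (tm_start M)"
proof unfold_locales
  show "tm_start M \<in> nats M" by (simp add: tm_start_def n_zero_def)
  show "valid (tm_start M)" unfolding valid_def tm_start_def n_zero_def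
    using n_pos by (intro bexI[of _ "vempty M"]) simp_all
  show "definable M (nats M) (\<lambda>e. valid (e 0))"
    unfolding valid_def by (intro arith_definable_rules definable_term_ctriple nkt)
  show "definable M (nats M) (\<lambda>e. tm_step M T (e 0) (e 1))"
    unfolding tm_step_iff move_def is_digit_def tape_move_def
    by (intro arith_definable_rules definable_term_ctriple nkt nthree_nat tm_base_nat)
      (simp_all add: n_zero_def n_one_def ntwo_eq)
  show "y \<in> nats M" if "x \<in> nats M" "tm_step M T x y" for x y
    using that unfolding tm_step_iff move_def by auto
  show "valid y" if "valid x" "tm_step M T x y" for x y
    using that unfolding tm_step_iff move_def valid_def by blast
  show "\<exists>y. tm_step M T x y" if valid_x: "valid x" for x
  proof -
    obtain q l r where qlr: "q \<in> nats M" "l \<in> nats M" "r \<in> nats M" "x = ctriple M q l r" "q \<prec> n \<or> q = n"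
      using valid_x unfolding valid_def by blast
    show ?thesis
    proof (cases "q = n")
      case True
      then show ?thesis using qlr tm_step_halt by blast
    next
      case False
      obtain r0 a where ra: "r0 \<in> nats M" "a \<in> nats M" "a \<prec> k" "r = r0 \<otimes> k \<oplus> a"
        using divide_exists[OF k_pos _ qlr(3)] by auto
      obtain q' a' m where "q' \<in> nats M" "a' \<in> nats M" "m \<in> nats M" "q' \<prec> n \<or> q' = n" "a' \<prec> k"
        and m: "m \<prec> nthree M"
        and "is_digit M (tm_base M n k) t (q \<otimes> k \<oplus> a) ((q' \<otimes> k \<oplus> a') \<otimes> nthree M \<oplus> m)"
        using digit_total[OF qlr(1) ra(2)] by blast
      moreover from this obtain l' r' where "l' \<in> nats M" "r' \<in> nats M" "tape_move M k m l a' r0 l' r'"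
        using tape_move_total[of m l a' r0] qlr ra by blast
      ultimately have "move q l r a r0 q' a' m l' r' (ctriple M q' l' r')"
        and "q' \<in> nats M" "a' \<in> nats M" "m \<in> nats M" "l' \<in> nats M" "r' \<in> nats M"
        using ra unfolding move_def by blast+
      then have "tm_step M T x (ctriple M q' l' r')" using qlr False ra tm_step_move by simp
      then show ?thesis by blast
    qed
  qed
  fix x y y' assume valid_x: "valid x" and steps: "tm_step M T x y" "tm_step M T x y'"
  obtain q l r where qlr: "q \<in> nats M" "l \<in> nats M" "r \<in> nats M" "x = ctriple M q l r"
    using valid_x unfolding valid_def by blast
  show "y = y'"
    using steps(1) unfolding qlr(4)
  proof (cases rule: tm_step_cases[OF _ qlr(1-3), consumes 1, case_names halt move])
    case halt1: halt
    show ?thesis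
      using steps(2) unfolding qlr(4)
    proof (cases rule: tm_step_cases[OF _ qlr(1-3), consumes 1, case_names halt move])
      case halt
      with halt1 show ?thesis by simp
    next
      case move
      with halt1 less_irrefl[of n] show ?thesis by simp
    qed
  next
    case (move a r0 q' a' m l' r')
    note move1 = this
    show ?thesis
      using steps(2) unfolding qlr(4)
    proof (cases rule: tm_step_cases[OF _ qlr(1-3), consumes 1, case_names halt move])
      case halt
      with move1 less_irrefl[of n] show ?thesis by simp
    next
      case (move b u0 p' b' j x' z')
      show ?thesis by (rule move_unique[OF move1(9) move(9) qlr(1) move1(2-7) move(2-7)])
    qed
  qed
qed

lemma tm_run_eq: "tm_run M T z = iteration.result M (tm_step M T) (tm_start M) z"
  by (simp add: tm_run_def iteration.result_def[OF tm_iteration])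

end

subsection \<open>Initial-segment number extensions\<close>

locale number_extension = V1: zf V1 + V2: zf V2
  for V1 :: "('a, 'b) struct_scheme" and V2 :: "('a, 'c) struct_scheme" +
  fixes f :: "'a \<Rightarrow> 'a"
  assumes extends: "initial_segment_number_extends V2 V1 f"
begin

lemma f_nat [simp]: "a \<in> nats V1 \<Longrightarrow> f a \<in> nats V2"
  using extends by (auto simp: initial_segment_number_extends_def)

lemma f_arith [simp]:
  assumes "a \<in> nats V1" "b \<in> nats V1"
  shows "f (a \<oplus>\<^bsub>V1\<^esub> b) = f a \<oplus>\<^bsub>V2\<^esub> f b" "f (a \<otimes>\<^bsub>V1\<^esub> b) = f a \<otimes>\<^bsub>V2\<^esub> f b"
    "f (a \<up>\<^bsub>V1\<^esub> b) = f a \<up>\<^bsub>V2\<^esub> f b"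
  using extends assms by (auto simp: initial_segment_number_extends_def)

lemma f_zero_one [simp]: "f \<zero>\<^bsub>V1\<^esub> = \<zero>\<^bsub>V2\<^esub>" "f \<one>\<^bsub>V1\<^esub> = \<one>\<^bsub>V2\<^esub>"
  using extends by (auto simp: initial_segment_number_extends_def)

lemma zero_one_nat [simp]: "\<zero>\<^bsub>V1\<^esub> \<in> nats V1" "\<one>\<^bsub>V1\<^esub> \<in> nats V1"
  by (simp_all add: n_zero_def n_one_def)

lemma f_vempty [simp]: "f (vempty V1) = vempty V2"
  using f_zero_one(1) by (simp add: n_zero_def)

lemma f_vsucc [simp]: "a \<in> nats V1 \<Longrightarrow> f (vsucc V1 a) = vsucc V2 (f a)"
  using f_arith(1)[of a "\<one>\<^bsub>V1\<^esub>"] f_zero_one(2) by (simp add: n_one_def)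

text \<open>The order is reduced to addition, b = a + c + 1, which f preserves.\<close>

lemma f_less:
  assumes "a \<prec>\<^bsub>V1\<^esub> b" "a \<in> nats V1" "b \<in> nats V1" shows "f a \<prec>\<^bsub>V2\<^esub> f b"
proof -
  obtain c where c: "c \<in> nats V1" "b = a \<oplus>\<^bsub>V1\<^esub> vsucc V1 c" using assms by (rule V1.lessE)
  have "f b = f a \<oplus>\<^bsub>V2\<^esub> vsucc V2 (f c)" unfolding c(2) using assms c(1) by (simp del: V1.add_vsucc V2.add_vsucc)
  then show ?thesis using V2.less_add_vsucc assms(2) c(1) by simp
qed

text \<open>Sharpens the initial-segment property: the preimage is itself below b, by linearity in
  V1 and strict monotonicity of f.\<close>

lemma f_initial:
  assumes "a \<prec>\<^bsub>V2\<^esub> f b" "a \<in> nats V2" "b \<in> nats V1"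
  obtains c where "c \<in> nats V1" "c \<prec>\<^bsub>V1\<^esub> b" "a = f c"
proof -
  obtain c where c: "c \<in> nats V1" "a = f c"
    using extends assms unfolding initial_segment_number_extends_def by blast
  moreover have "c \<prec>\<^bsub>V1\<^esub> b"
    using V1.less_linear[of c b] f_less[of b c] assms c V2.less_asym[of a "f b"] V2.less_irrefl[of a] by auto
  ultimately show ?thesis using that by blast
qed

lemma nthree_nat [simp]: "ntwo V1 \<in> nats V1" "nthree V1 \<in> nats V1"
  by (simp_all add: ntwo_def nthree_def)

lemma f_nthree [simp]: "f (ntwo V1) = ntwo V2" "f (nthree V1) = nthree V2"
  by (simp_all add: ntwo_def nthree_def)

lemma f_cpair: "x \<in> nats V1 \<Longrightarrow> y \<in> nats V1 \<Longrightarrow> f (cpair V1 x y) = cpair V2 (f x) (f y)"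
  by (simp add: cpair_def)

lemma f_ctriple [simp]:
  "x \<in> nats V1 \<Longrightarrow> y \<in> nats V1 \<Longrightarrow> z \<in> nats V1 \<Longrightarrow> f (ctriple V1 x y z) = ctriple V2 (f x) (f y) (f z)"
  by (simp add: ctriple_def f_cpair)

lemma f_tm_base [simp]: "n \<in> nats V1 \<Longrightarrow> k \<in> nats V1 \<Longrightarrow> f (tm_base V1 n k) = tm_base V2 (f n) (f k)"
  by (simp add: tm_base_def)

lemma tm_base_nat [simp]: "n \<in> nats V1 \<Longrightarrow> k \<in> nats V1 \<Longrightarrow> tm_base V1 n k \<in> nats V1"
  by (simp add: tm_base_def)

lemma f_is_digit:
  assumes "is_digit V1 b t i d" "b \<in> nats V1" "i \<in> nats V1" "d \<in> nats V1"
  shows "is_digit V2 (f b) (f t) (f i) (f d)"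
proof -
  obtain u v where uv: "d \<prec>\<^bsub>V1\<^esub> b" "u \<in> nats V1" "v \<in> nats V1" "v \<prec>\<^bsub>V1\<^esub> b \<up>\<^bsub>V1\<^esub> i"
    "t = ((u \<otimes>\<^bsub>V1\<^esub> b) \<oplus>\<^bsub>V1\<^esub> d) \<otimes>\<^bsub>V1\<^esub> (b \<up>\<^bsub>V1\<^esub> i) \<oplus>\<^bsub>V1\<^esub> v"
    using assms(1) unfolding is_digit_def by blast
  have "f v \<prec>\<^bsub>V2\<^esub> f b \<up>\<^bsub>V2\<^esub> f i" using f_less[OF uv(4)] uv assms by simp
  moreover have "f t = ((f u \<otimes>\<^bsub>V2\<^esub> f b) \<oplus>\<^bsub>V2\<^esub> f d) \<otimes>\<^bsub>V2\<^esub> (f b \<up>\<^bsub>V2\<^esub> f i) \<oplus>\<^bsub>V2\<^esub> f v"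
    unfolding uv(5) using uv(2,3) assms by simp
  moreover have "f d \<prec>\<^bsub>V2\<^esub> f b" using f_less uv(1) assms by blast
  ultimately show ?thesis unfolding is_digit_def using uv(2,3) f_nat by blast
qed

lemma f_codes_tm:
  assumes "codes_tm V1 T n k t" shows "codes_tm V2 (f T) (f n) (f k) (f t)"
proof -
  have N: "n \<in> nats V1" "k \<in> nats V1" "t \<in> nats V1" using assms by (auto simp: codes_tm_def)
  then have "f t \<prec>\<^bsub>V2\<^esub> f (tm_base V1 n k \<up>\<^bsub>V1\<^esub> (n \<otimes>\<^bsub>V1\<^esub> k))"
    "f \<zero>\<^bsub>V1\<^esub> \<prec>\<^bsub>V2\<^esub> f n" "f \<one>\<^bsub>V1\<^esub> \<prec>\<^bsub>V2\<^esub> f k"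
    \<comment> \<open>With the rules for f switched off, both sides keep the form of a value of f,
      as \<open>f_less\<close> expects.\<close>
    using assms by (auto simp: codes_tm_def simp del: f_arith f_zero_one intro!: f_less)
  then show ?thesis using assms N by (simp add: codes_tm_def)
qed

lemma f_tape_move:
  assumes "tape_move V1 k m l a r l' r'" "k \<in> nats V1" "a \<in> nats V1" "l \<in> nats V1" "r \<in> nats V1"
    "l' \<in> nats V1" "r' \<in> nats V1"
  shows "tape_move V2 (f k) (f m) (f l) (f a) (f r) (f l') (f r')"
  using assms(1) unfolding tape_move_def
proof (elim disjE conjE bexE)
  fix c assume c: "m = \<one>\<^bsub>V1\<^esub>" "c \<in> nats V1" "c \<prec>\<^bsub>V1\<^esub> k" "l = l' \<otimes>\<^bsub>V1\<^esub> k \<oplus>\<^bsub>V1\<^esub> c"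
    "r' = (r \<otimes>\<^bsub>V1\<^esub> k \<oplus>\<^bsub>V1\<^esub> a) \<otimes>\<^bsub>V1\<^esub> k \<oplus>\<^bsub>V1\<^esub> c"
  have "f l = f l' \<otimes>\<^bsub>V2\<^esub> f k \<oplus>\<^bsub>V2\<^esub> f c" "f r' = (f r \<otimes>\<^bsub>V2\<^esub> f k \<oplus>\<^bsub>V2\<^esub> f a) \<otimes>\<^bsub>V2\<^esub> f k \<oplus>\<^bsub>V2\<^esub> f c"
    "f m = \<one>\<^bsub>V2\<^esub>"
    using assms(2,3,5,6) c(2) by (simp_all add: c(1,4,5))
  moreover have "f c \<prec>\<^bsub>V2\<^esub> f k" using f_less c(2,3) assms(2) by blast
  ultimately show "f m = \<zero>\<^bsub>V2\<^esub> \<and> f l' = f l \<and> f r' = f r \<otimes>\<^bsub>V2\<^esub> f k \<oplus>\<^bsub>V2\<^esub> f a \<or>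
    f m = \<one>\<^bsub>V2\<^esub> \<and> (\<exists>c\<in>nats V2. c \<prec>\<^bsub>V2\<^esub> f k \<and> f l = f l' \<otimes>\<^bsub>V2\<^esub> f k \<oplus>\<^bsub>V2\<^esub> c \<and>
      f r' = (f r \<otimes>\<^bsub>V2\<^esub> f k \<oplus>\<^bsub>V2\<^esub> f a) \<otimes>\<^bsub>V2\<^esub> f k \<oplus>\<^bsub>V2\<^esub> c) \<or>
    f m = ntwo V2 \<and> f l' = f l \<otimes>\<^bsub>V2\<^esub> f k \<oplus>\<^bsub>V2\<^esub> f a \<and> f r' = f r"
    using f_nat[OF c(2)] by blast
qed (use assms(2-) in simp_all)

text \<open>The witnesses of the step are mapped by f. Only this direction is transferred;
  determinism in V2 will make the image the only possible successor.\<close>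

lemma f_tm_step:
  assumes code: "codes_tm V1 T n k t" and step: "tm_step V1 T s s'"
  shows "tm_step V2 (f T) (f s) (f s')"
proof -
  interpret T1: turing V1 T n k t using code by unfold_locales
  interpret T2: turing V2 "f T" "f n" "f k" "f t" using f_codes_tm[OF code] by unfold_locales
  obtain q l r where qlr: "q \<in> nats V1" "l \<in> nats V1" "r \<in> nats V1" "s = ctriple V1 q l r"
    and step': "q = n \<and> s' = s \<or> q \<prec>\<^bsub>V1\<^esub> n \<and>
       (\<exists>a\<in>nats V1. \<exists>r0\<in>nats V1. \<exists>q'\<in>nats V1. \<exists>a'\<in>nats V1. \<exists>m\<in>nats V1. \<exists>l'\<in>nats V1. \<exists>r'\<in>nats V1.
          T1.move q l r a r0 q' a' m l' r' s')"
    using step[unfolded T1.tm_step_iff] by (elim bexE conjE) (rule that)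
  have s: "f s = ctriple V2 (f q) (f l) (f r)" using qlr by simp
  from step' show ?thesis
  proof (elim disjE conjE bexE)
    assume "q = n" "s' = s"
    then show ?thesis using s qlr T2.tm_step_halt by simp
  next
    fix a r0 q' a' m l' r'
    assume qn: "q \<prec>\<^bsub>V1\<^esub> n" and N: "a \<in> nats V1" "r0 \<in> nats V1" "q' \<in> nats V1" "a' \<in> nats V1"
      "m \<in> nats V1" "l' \<in> nats V1" "r' \<in> nats V1" and mv: "T1.move q l r a r0 q' a' m l' r' s'"
    have qn': "f q \<prec>\<^bsub>V2\<^esub> f n" using qn qlr f_less by simp
    have mv': "T2.move (f q) (f l) (f r) (f a) (f r0) (f q') (f a') (f m) (f l') (f r') (f s')"
      unfolding T2.move_def
    proof (intro conjI)
      show "f a \<prec>\<^bsub>V2\<^esub> f k" "f a' \<prec>\<^bsub>V2\<^esub> f k" "f q' \<prec>\<^bsub>V2\<^esub> f n \<or> f q' = f n"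
        using mv N f_less unfolding T1.move_def by auto
      show "f m \<prec>\<^bsub>V2\<^esub> nthree V2" using mv N f_less[of m "nthree V1"] unfolding T1.move_def by simp
      show "f r = f r0 \<otimes>\<^bsub>V2\<^esub> f k \<oplus>\<^bsub>V2\<^esub> f a" "f s' = ctriple V2 (f q') (f l') (f r')"
        using mv N unfolding T1.move_def by simp_all
      show "tape_move V2 (f k) (f m) (f l) (f a') (f r0) (f l') (f r')"
        using mv N qlr unfolding T1.move_def by (intro f_tape_move) auto
      have "is_digit V2 (f (tm_base V1 n k)) (f t) (f (q \<otimes>\<^bsub>V1\<^esub> k \<oplus>\<^bsub>V1\<^esub> a))
          (f ((q' \<otimes>\<^bsub>V1\<^esub> k \<oplus>\<^bsub>V1\<^esub> a') \<otimes>\<^bsub>V1\<^esub> nthree V1 \<oplus>\<^bsub>V1\<^esub> m))"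
        using mv N qlr unfolding T1.move_def by (intro f_is_digit) simp_all
      then show "is_digit V2 (tm_base V2 (f n) (f k)) (f t) (f q \<otimes>\<^bsub>V2\<^esub> f k \<oplus>\<^bsub>V2\<^esub> f a)
          ((f q' \<otimes>\<^bsub>V2\<^esub> f k \<oplus>\<^bsub>V2\<^esub> f a') \<otimes>\<^bsub>V2\<^esub> nthree V2 \<oplus>\<^bsub>V2\<^esub> f m)"
        using N qlr by simp
    qed
    show ?thesis unfolding s
      by (rule T2.tm_step_move[OF mv' qn']) (use qlr(1-3) N in simp_all)
  qed
qed

lemma f_tm_run:
  assumes code: "codes_tm V1 T n k t" and z: "z \<in> nats V1"
  shows "f (tm_run V1 T z) = tm_run V2 (f T) (f z)"
proof -
  interpret T1: turing V1 T n k t using code by unfold_locales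
  interpret T2: turing V2 "f T" "f n" "f k" "f t" using f_codes_tm[OF code] by unfold_locales
  interpret I1: iteration V1 "tm_step V1 T" T1.valid "tm_start V1" by (rule T1.tm_iteration)
  interpret I2: iteration V2 "tm_step V2 (f T)" T2.valid "tm_start V2" by (rule T2.tm_iteration)
  \<comment> \<open>The bound is z + 1, since the states numbered 0 to z are all coded.\<close>
  obtain B c where B: "B \<in> nats V1" and c: "c \<in> nats V1"
    and code_c: "\<And>i. i \<in> nats V1 \<Longrightarrow> i \<prec>\<^bsub>V1\<^esub> vsucc V1 z \<Longrightarrow> is_digit V1 B c i (I1.result i)"
    using V1.ex_code[OF I1.result_closed(1) I1.definable_term_result[OF V1.definable_term_var] V1.vsucc_nat[OF z]]
    by blast
  have digit: "is_digit V2 (f B) (f c) (f i) (f (I1.result i))"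
    if "i \<in> nats V1" "i \<prec>\<^bsub>V1\<^esub> vsucc V1 z" for i
    using f_is_digit[OF code_c[OF that] B that(1) I1.result_closed(1)[OF that(1)]] .
  \<comment> \<open>Leads from the statement fit for induction in V2 to the equation wanted. The
    equation cannot be inducted on directly, as it applies f to a variable.\<close>
  have result_eq: "I2.result (f i) = f (I1.result i)"
    if "is_digit V2 (f B) (f c) (f i) (I2.result (f i))" "i \<in> nats V1" "i \<prec>\<^bsub>V1\<^esub> vsucc V1 z" for i
    using V2.is_digit_unique[OF that(1) digit[OF that(2,3)]] B that(2) I1.result_closed(1) I2.result_closed(1)
    by simp
  have "i \<prec>\<^bsub>V2\<^esub> vsucc V2 (f z) \<longrightarrow> is_digit V2 (f B) (f c) i (I2.result i)" if "i \<in> nats V2" for i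
    using that
  proof (induction rule: V2.nats_induct)
    case definable
    show ?case unfolding is_digit_def
      by (intro V2.arith_definable_rules I2.definable_term_result V2.vsucc_nat f_nat B c z)
  next
    case zero
    have "f (tm_start V1) = tm_start V2" by (simp add: tm_start_def)
    then show ?case
      using digit[of "vempty V1"] V1.zero_less_vsucc[OF z] by (simp add: I1.result_zero I2.result_zero)
  next
    case (succ i)
    show ?case
    proof
      assume less: "vsucc V2 i \<prec>\<^bsub>V2\<^esub> vsucc V2 (f z)"
      then have "i \<prec>\<^bsub>V2\<^esub> f z" using V2.less_of_vsucc_less[OF succ(1)] z by simp
      then obtain j where j: "j \<in> nats V1" "j \<prec>\<^bsub>V1\<^esub> z" "i = f j" using succ(1) z by (rule f_initial)
      have jz: "j \<prec>\<^bsub>V1\<^esub> vsucc V1 z" "vsucc V1 j \<prec>\<^bsub>V1\<^esub> vsucc V1 z"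
        using j z V1.vsucc_less_vsucc by (simp_all add: V1.less_vsucc)
      have "i \<prec>\<^bsub>V2\<^esub> vsucc V2 (f z)" using \<open>i \<prec>\<^bsub>V2\<^esub> f z\<close> succ(1) z by (simp add: V2.less_vsucc)
      then have eq: "I2.result i = f (I1.result j)"
        using succ(2) result_eq[of j] j jz by simp
      have "tm_step V2 (f T) (f (I1.result j)) (f (I1.result (vsucc V1 j)))"
        using f_tm_step[OF code I1.result_vsucc[OF j(1)]] .
      \<comment> \<open>The image of V1's step and V2's own step start from the same state, so they
        end in the same state.\<close>
      then have "I2.result (vsucc V2 i) = f (I1.result (vsucc V1 j))"
        using I2.step_unique[of "I2.result i"] I2.result_vsucc[OF succ(1)] I2.result_closed[OF succ(1)] eq
        by metis
      then show "is_digit V2 (f B) (f c) (vsucc V2 i) (I2.result (vsucc V2 i))"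
        using digit[of "vsucc V1 j"] j jz by simp
    qed
  qed
  from this[of "f z"] have "I2.result (f z) = f (I1.result z)"
    using result_eq[of z] z by (simp add: V1.less_vsucc V2.less_vsucc)
  then show ?thesis by (simp add: T1.tm_run_eq T2.tm_run_eq)
qed

end

theorem mainTheorem3:
  fixes V1 V2 :: "'a struct" and f :: "'a \<Rightarrow> 'a" and T1 z :: 'a
  assumes "ZF_model V1" and "ZF_model V2"
    and "is_set_of V2 V1"
    and "initial_segment_number_extends V2 V1 f"
    and "T1 \<in> nats V1" and "is_tm V1 T1"
    and "z \<in> nats V1"
  shows "f (tm_run V1 T1 z) = tm_run V2 (f T1) (f z)"
proof -
  interpret number_extension V1 V2 f using assms(1,2,4) by unfold_locales
  obtain n k t where "codes_tm V1 T1 n k t" using assms(6) unfolding is_tm_def by blast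
  then show ?thesis using assms(7) by (rule f_tm_run)
qed

end
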